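(* Let $p>1$, let $\alpha\in[0,\pi_p)$, $\beta\in(0,\pi_p]$, and let $q,w,f$ satisfy conditions (C1)–(C3) listed in the context. Consider the boundary value problem $$-(y'^{(p-1)})'+(p-1)q(x)y^{(p-1)}=(p-1)w(x)f(y)\quad\text{on }(0,1),$$ $$S_p'(\alpha)y(0)-S_p(\alpha)y'(0)=0,\qquad S_p'(\beta)y(1)-S_p(\beta)y'(1)=0,$$ denoted (BVP), and let $\lambda_0<\lambda_1<\lambda_2<\cdots$ be the eigenvalues of the associated $p$-Laplacian eigenvalue problem defined in the context. Then: (i) If for some $n$ one has $\frac{f(y)}{y^{p-1}}<\lambda_n$ for all $y\in(0,\infty)$, then (BVP) has no solution with exactly $i$ zeros in $(0,1)$ for any $i\ge n$. (ii) If for some $n$ one has $\lambda_n<\frac{f(y)}{y^{p-1}}$ for all $y\in(0,\infty)$, then (BVP) has no solution with exactly $i$ zeros in $(0,1)$ for any $i\le n$. (iii) If $\frac{f(y)}{y^{p-1}}\ne\lambda_n$ for all $y\in(0,\infty)$ and every $n$, then (BVP) has no nontrivial solution.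
   Context: Notation: for real $y$, $y^{(p-1)}=|y|^{p-1}\operatorname{sgn}y=|y|^{p-2}y$, and $y'^{(p-1)}=|y'|^{p-2}y'$. Put $\pi_p=\int_0^1\frac{2\,dt}{(1-t^p)^{1/p}}=\frac{2\pi/p}{\sin(\pi/p)}$. The generalized sine function $S_p$ is defined on $[0,\pi_p/2]$ as the inverse of $w\mapsto\int_0^w\frac{dt}{(1-t^p)^{1/p}}$, $0\le w\le1$, and extended by $S_p(x)=S_p(\pi_p-x)$ for $\pi_p/2\le x\le\pi_p$, $S_p(x)=-S_p(x-\pi_p)$ for $\pi_p\le x\le2\pi_p$, and $2\pi_p$-periodically to $\mathbb{R}$. It solves $(y'^{(p-1)})'=-(p-1)y^{(p-1)}$, $y(0)=0$, $y'(0)=1$. $S_p'$ is its derivative. Conditions: (C1) $q,w\in C^1[0,1]$ and $w>0$ on $[0,1]$. (C2) $f\in C(\mathbb{R})$, $f(s)>0$ for $s>0$, $f(-s)=-f(s)$ for $s>0$, and $f$ is locally Lipschitz continuous on $(0,\infty)$. (C3) There exist $0\le f_0,f_\infty\le\infty$ with $\lim_{s\to0^+}\frac{f(s)}{s^{p-1}}=f_0$ and $\lim_{s\to\infty}\frac{f(s)}{s^{p-1}}=f_\infty$. Eigenvalue problem: $-(y'^{(p-1)})'=(p-1)(\lambda w(x)-q(x))y^{(p-1)}$ on $(0,1)$, with the same boundary conditions $S_p'(\alpha)y(0)-S_p(\alpha)y'(0)=0$, $S_p'(\beta)y(1)-S_p(\beta)y'(1)=0$. It is known that its eigenvalues form a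 sequence $-\infty<\lambda_0<\lambda_1<\cdots<\lambda_n<\cdots\to\infty$ and that an eigenfunction corresponding to $\lambda_n$ has exactly $n$ zeros in $(0,1)$. Indices $n,i$ range over nonnegative integers. *)

theory Defs
  imports "HOL-Analysis.Analysis" "HOL-Library.Real_Mod"
begin

text \<open>The signed power \<open>y\<^sup>(\<^sup>p\<^sup>-\<^sup>1\<^sup>)\<close>.\<close>

definition spow :: "real \<Rightarrow> real \<Rightarrow> real" where
  "spow p y = \<bar>y\<bar> powr (p - 1) * sgn y"

definition garcsin :: "real \<Rightarrow> real \<Rightarrow> real" where
  "garcsin p w = integral {0..w} (\<lambda>t. 1 / (1 - t powr p) powr (1 / p))"

definition gpi :: "real \<Rightarrow> real" where
  "gpi p = integral {0..1} (\<lambda>t. 2 / (1 - t powr p) powr (1 / p))"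

definition gsin_quarter :: "real \<Rightarrow> real \<Rightarrow> real" where
  "gsin_quarter p = the_inv_into {0..1} (garcsin p)"

definition gsin_half :: "real \<Rightarrow> real \<Rightarrow> real" where
  "gsin_half p x = (if x \<le> gpi p / 2 then gsin_quarter p x else gsin_quarter p (gpi p - x))"

text \<open>The generalized sine \<open>S\<^sub>p\<close>; its derivative \<open>S\<^sub>p'\<close> is \<^term>\<open>deriv (gsin p)\<close>.\<close>

definition gsin :: "real \<Rightarrow> real \<Rightarrow> real" where
  "gsin p x =
    (let z = x rmod (2 * gpi p)
     in if z \<le> gpi p then gsin_half p z else - gsin_half p (z - gpi p))"

text \<open>
  Derivatives on the closed interval \<open>[0,1]\<close> are one-sided at the end points, so that nothing
  depends on the values of a function outside \<open>[0,1]\<close>.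
\<close>

definition D01 :: "(real \<Rightarrow> real) \<Rightarrow> real \<Rightarrow> real" where
  "D01 y x = vector_derivative y (at x within {0..1})"

definition C1_01 :: "(real \<Rightarrow> real) \<Rightarrow> bool" where
  "C1_01 y \<longleftrightarrow> y differentiable_on {0..1} \<and> continuous_on {0..1} (D01 y)"

definition cond_C1 :: "(real \<Rightarrow> real) \<Rightarrow> (real \<Rightarrow> real) \<Rightarrow> bool" where
  "cond_C1 q w \<longleftrightarrow> C1_01 q \<and> C1_01 w \<and> (\<forall>x\<in>{0..1}. w x > 0)"

definition cond_C2 :: "(real \<Rightarrow> real) \<Rightarrow> bool" where
  "cond_C2 f \<longleftrightarrow>
    continuous_on UNIV f \<and> (\<forall>s>0. f s > 0) \<and> (\<forall>s>0. f (- s) = - f s) \<and>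
    (\<forall>s>0. \<exists>\<epsilon>>0. \<exists>L. L-lipschitz_on (cball s \<epsilon> \<inter> {0<..}) f)"

definition cond_C3 :: "real \<Rightarrow> (real \<Rightarrow> real) \<Rightarrow> bool" where
  "cond_C3 p f \<longleftrightarrow>
    (\<exists>f0 finf :: ereal. 0 \<le> f0 \<and> 0 \<le> finf \<and>
      ((\<lambda>s. ereal (f s / s powr (p - 1))) \<longlongrightarrow> f0) (at_right 0) \<and>
      ((\<lambda>s. ereal (f s / s powr (p - 1))) \<longlongrightarrow> finf) at_top)"

definition boundary_conditions :: "real \<Rightarrow> real \<Rightarrow> real \<Rightarrow> (real \<Rightarrow> real) \<Rightarrow> bool" where
  "boundary_conditions p \<alpha> \<beta> y \<longleftrightarrow>
    deriv (gsin p) \<alpha> * y 0 - gsin p \<alpha> * D01 y 0 = 0 \<and>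
    deriv (gsin p) \<beta> * y 1 - gsin p \<beta> * D01 y 1 = 0"

text \<open>Solutions are classical: \<open>y \<in> C\<^sup>1[0,1]\<close>, and the flux \<open>y'\<^sup>(\<^sup>p\<^sup>-\<^sup>1\<^sup>)\<close> is differentiable on \<open>(0,1)\<close>.\<close>

definition regular :: "real \<Rightarrow> (real \<Rightarrow> real) \<Rightarrow> bool" where
  "regular p y \<longleftrightarrow>
    C1_01 y \<and> (\<forall>x\<in>{0<..<1}. (\<lambda>t. spow p (D01 y t)) differentiable (at x))"

definition bvp_solution ::
  "real \<Rightarrow> real \<Rightarrow> real \<Rightarrow> (real \<Rightarrow> real) \<Rightarrow> (real \<Rightarrow> real) \<Rightarrow> (real \<Rightarrow> real) \<Rightarrow> (real \<Rightarrow> real) \<Rightarrow> bool"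
  where
  "bvp_solution p \<alpha> \<beta> q w f y \<longleftrightarrow>
    regular p y \<and>
    (\<forall>x\<in>{0<..<1}.
      - deriv (\<lambda>t. spow p (D01 y t)) x + (p - 1) * q x * spow p (y x) = (p - 1) * w x * f (y x)) \<and>
    boundary_conditions p \<alpha> \<beta> y"

definition nontrivial :: "(real \<Rightarrow> real) \<Rightarrow> bool" where
  "nontrivial y \<longleftrightarrow> (\<exists>x\<in>{0..1}. y x \<noteq> 0)"

definition eigenfunction ::
  "real \<Rightarrow> real \<Rightarrow> real \<Rightarrow> (real \<Rightarrow> real) \<Rightarrow> (real \<Rightarrow> real) \<Rightarrow> real \<Rightarrow> (real \<Rightarrow> real) \<Rightarrow> bool" where
  "eigenfunction p \<alpha> \<beta> q w l y \<longleftrightarrow>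
    nontrivial y \<and> regular p y \<and>
    (\<forall>x\<in>{0<..<1}.
      - deriv (\<lambda>t. spow p (D01 y t)) x = (p - 1) * (l * w x - q x) * spow p (y x)) \<and>
    boundary_conditions p \<alpha> \<beta> y"

definition eigenvalue ::
  "real \<Rightarrow> real \<Rightarrow> real \<Rightarrow> (real \<Rightarrow> real) \<Rightarrow> (real \<Rightarrow> real) \<Rightarrow> real \<Rightarrow> bool" where
  "eigenvalue p \<alpha> \<beta> q w l \<longleftrightarrow> (\<exists>y. eigenfunction p \<alpha> \<beta> q w l y)"

definition has_exactly_zeros :: "nat \<Rightarrow> (real \<Rightarrow> real) \<Rightarrow> bool" where
  "has_exactly_zeros i y \<longleftrightarrow>
    finite {x \<in> {0<..<1}. y x = 0} \<and> card {x \<in> {0<..<1}. y x = 0} = i"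

end

theory Submission
  imports Defs
begin

text \<open>
  The idea is Sturm comparison. Along a solution \<open>y\<close> of the boundary value problem, put
  \<open>g(s) = f(\<bar>s\<bar>) / \<bar>s\<bar>\<^sup>p\<^sup>-\<^sup>1\<close>. Then \<open>f(y) = g(y) y\<^sup>(\<^sup>p\<^sup>-\<^sup>1\<^sup>)\<close>, so \<open>y\<close> solves the half-linear equation with the potential
  \<open>g(y(x)) w(x) - q(x)\<close>, whereas an eigenfunction of \<open>\<lambda>\<close> solves it with the potential \<open>\<lambda> w(x) - q(x)\<close>. Under
  common boundary conditions, the solution with the larger potential has at least one more zero. Hence
  \<open>g < \<lambda>\<^sub>n\<close> forces fewer than \<open>n\<close> zeros and \<open>g > \<lambda>\<^sub>n\<close> forces more than \<open>n\<close>, provided that eigenfunctions of \<open>\<lambda>\<^sub>n\<close>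
  have \<open>n\<close> zeros. If \<open>g\<close> avoids all eigenvalues, which are unbounded above, then by connectedness its
  values all lie below \<open>\<lambda>\<^sub>0\<close> or all lie in one gap
  \<open>(\<lambda>\<^sub>k, \<lambda>\<^sub>k\<^sub>+\<^sub>1)\<close>, and the number of zeros would have to be negative or strictly between \<open>k\<close> and \<open>k + 1\<close>.

  The comparison (\<open>sturm_comparison_bvp\<close>) rests on Picone's identity (\<open>picone_DERIV\<close>). Its boundary terms
  vanish even where \<open>y\<close> is zero as long as the zeros of \<open>y\<close> are simple. For bounded \<open>g\<close> this is the usual
  uniqueness argument (\<open>simple_zeros_if_bounded\<close>). In the case \<open>g > \<lambda>\<^sub>n\<close> the ratio may be unbounded near
  \<open>0\<close>; then positivity of \<open>f\<close> bounds the derivative of the flux \<open>y'\<^sup>(\<^sup>p\<^sup>-\<^sup>1\<^sup>)\<close> on one side, which is enough for a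
  solution with finitely many zeros (\<open>simple_zeros_if_finite\<close>).

  It remains to count the zeros of eigenfunctions when only the increasing enumeration of the eigenvalues
  is given. Comparison of consecutive eigenfunctions gives at least \<open>n\<close> zeros for \<open>\<lambda>\<^sub>n\<close>. For the upper
  bound, enough eigenfunctions with few zeros must be constructed (\<open>eigenfunction_few_zeros\<close>). This is done by
  shooting (\<open>shooting\<close>) in the coordinates \<open>y = r sin \<theta>\<close>, \<open>y'\<^sup>(\<^sup>p\<^sup>-\<^sup>1\<^sup>) = r\<^sup>p\<^sup>-\<^sup>1 cos \<theta>\<close> with the ordinary sine and
  cosine. They give a scalar Lipschitz equation for \<open>\<theta>\<close>, the zeros of \<open>y\<close> are the upward passages of \<open>\<theta>\<close>
  through multiples of \<open>\<pi>\<close>, and boundary conditions become values of \<open>\<theta>\<close>. The generalized sine therefore enters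
  only through the fact that \<open>S\<^sub>p\<close> and \<open>S\<^sub>p'\<close> have no common zero (\<open>gsin_nondegenerate\<close>).
\<close>

section \<open>The signed power\<close>

lemma spow_0 [simp]: "spow p 0 = 0"
  by (simp add: spow_def)

lemma spow_eq_0_iff [simp]: "spow p y = 0 \<longleftrightarrow> y = 0"
  by (simp add: spow_def sgn_zero_iff)

lemma sgn_spow [simp]: "sgn (spow p y) = sgn y"
  by (simp add: spow_def sgn_mult) (auto simp: sgn_if)

lemma spow_pos: "y > 0 \<Longrightarrow> spow p y = y powr (p - 1)"
  by (simp add: spow_def)

lemma abs_spow: "\<bar>spow p y\<bar> = \<bar>y\<bar> powr (p - 1)"
  by (simp add: spow_def abs_mult sgn_if)

lemma spow_mult: "spow p (a * b) = spow p a * spow p b"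
  by (simp add: spow_def abs_mult powr_mult sgn_mult)

lemma spow_divide: "spow p (a / b) = spow p a / spow p b"
  by (simp add: spow_def powr_divide sgn_divide) (simp add: sgn_if)

lemma mult_spow: "y * spow p y = \<bar>y\<bar> powr p"
proof (cases "y = 0")
  case False
  have "\<bar>y\<bar> powr p = \<bar>y\<bar> powr 1 * \<bar>y\<bar> powr (p - 1)"
    by (subst powr_add [symmetric]) simp
  then show ?thesis using False by (simp add: spow_def sgn_if)
qed (simp add: spow_def)

lemma spow_mono:
  assumes "p > 1" "a \<le> b" shows "spow p a \<le> spow p b"
proof -
  consider "0 \<le> a" | "a < 0" "0 \<le> b" | "b < 0" using assms by linarith
  then show ?thesis
  proof cases
    case 1
    have "a powr (p - 1) \<le> b powr (p - 1)" using 1 assms by (intro powr_mono2) auto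
    then show ?thesis using 1 assms by (auto simp: spow_def sgn_if)
  next
    case 2
    then show ?thesis by (auto simp: spow_def sgn_if intro: order_trans [of _ 0])
  next
    case 3
    have "(- b) powr (p - 1) \<le> (- a) powr (p - 1)" using 3 assms by (intro powr_mono2) auto
    then show ?thesis using 3 assms by (auto simp: spow_def sgn_if)
  qed
qed

text \<open>
  Since \<open>(p - 1) (p' - 1) = 1\<close> for the conjugate exponent \<open>p' = p / (p - 1)\<close>, the signed powers
  of \<open>p\<close> and \<open>p'\<close> are inverse to each other; this recovers \<open>y'\<close> from the flux \<open>y'\<^sup>(\<^sup>p\<^sup>-\<^sup>1\<^sup>)\<close>.
\<close>

lemma spow_inverse:
  assumes "p > 1" shows "spow p (spow (p / (p - 1)) y) = y"
proof -
  have "p / (p - 1) - 1 = 1 / (p - 1)" using assms by (simp add: field_simps)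
  then show ?thesis using assms
    by (simp add: spow_def abs_mult sgn_mult powr_powr) (auto simp: sgn_if powr_powr)
qed

lemma spow_inverse':
  assumes "p > 1" shows "spow (p / (p - 1)) (spow p y) = y"
proof -
  have "p / (p - 1) - 1 = 1 / (p - 1)" using assms by (simp add: field_simps)
  then show ?thesis using assms
    by (simp add: spow_def abs_mult sgn_mult powr_powr) (auto simp: sgn_if powr_powr)
qed

lemma DERIV_abs_powr:
  assumes "p > 1"
  shows "((\<lambda>x. \<bar>x\<bar> powr p) has_real_derivative p * spow p x) (at x)"
proof -
  consider "x > 0" | "x < 0" | "x = 0" by linarith
  then show ?thesis
  proof cases
    case 1
    have "((\<lambda>x. x powr p) has_real_derivative p * x powr (p - 1)) (at x)"
      using 1 by (rule has_real_derivative_powr)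
    then have "((\<lambda>x. \<bar>x\<bar> powr p) has_real_derivative p * x powr (p - 1)) (at x)"
      by (rule has_field_derivative_transform_within_open [of _ _ _ "{0<..}"]) (use 1 in auto)
    then show ?thesis using 1 by (simp add: spow_pos)
  next
    case 2
    have "((\<lambda>x. (- x) powr p) has_real_derivative p * (- x) powr (p - 1) * (- 1)) (at x)"
      using 2 by (auto intro!: derivative_eq_intros simp: powr_diff)
    then have "((\<lambda>x. \<bar>x\<bar> powr p) has_real_derivative p * (- x) powr (p - 1) * (- 1)) (at x)"
      by (rule has_field_derivative_transform_within_open [of _ _ _ "{..<0}"]) (use 2 in auto)
    then show ?thesis using 2 by (simp add: spow_def)
  next
    case 3
    have "((\<lambda>h. \<bar>h\<bar> powr (p - 1)) \<longlongrightarrow> 0) (at 0)"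
      using assms by (intro tendsto_eq_intros | simp)+
    then have "((\<lambda>h. \<bar>(\<bar>h\<bar> powr p) / h\<bar>) \<longlongrightarrow> 0) (at 0)"
      by (rule Lim_transform_eventually)
         (auto simp: eventually_at_filter abs_divide powr_diff)
    then have "((\<lambda>h. (\<bar>h\<bar> powr p) / h) \<longlongrightarrow> 0) (at 0)"
      by (rule tendsto_rabs_zero_cancel)
    then show ?thesis using 3 assms by (simp add: DERIV_def)
  qed
qed

lemma DERIV_spow:
  assumes "y \<noteq> 0"
  shows "(spow p has_real_derivative (p - 1) * spow p y / y) (at y)"
proof (cases "y > 0")
  case True
  have "((\<lambda>x. x powr (p - 1)) has_real_derivative (p - 1) * y powr (p - 1 - 1)) (at y)"
    using True by (rule has_real_derivative_powr)
  then have "((\<lambda>x. x powr (p - 1)) has_real_derivative (p - 1) * spow p y / y) (at y)"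
    using True by (simp add: spow_pos powr_diff power2_eq_square)
  then show ?thesis
    by (rule has_field_derivative_transform_within_open [of _ _ _ "{0<..}"])
       (use True in \<open>auto simp: spow_pos\<close>)
next
  case False
  then have "y < 0" using assms by auto
  have "((\<lambda>x. - ((- x) powr (p - 1))) has_real_derivative (p - 1) * (- y) powr (p - 1 - 1)) (at y)"
  proof -
    have "((\<lambda>x. (- x) powr (p - 1)) has_real_derivative (p - 1) * (- y) powr (p - 1 - 1) * (- 1)) (at y)"
      by (rule DERIV_chain2 [of "\<lambda>z. z powr (p - 1)" _ uminus])
         (use \<open>y < 0\<close> in \<open>auto intro!: has_real_derivative_powr derivative_eq_intros\<close>)
    from DERIV_minus [OF this] show ?thesis by simp
  qed
  moreover have "(- y) powr (p - 1 - 1) = spow p y / y"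
    using \<open>y < 0\<close> by (simp add: spow_def powr_diff power2_eq_square)
  ultimately have "((\<lambda>x. - ((- x) powr (p - 1))) has_real_derivative (p - 1) * spow p y / y) (at y)"
    by simp
  then show ?thesis
    by (rule has_field_derivative_transform_within_open [of _ _ _ "{..<0}"])
       (use \<open>y < 0\<close> in \<open>auto simp: spow_def\<close>)
qed

lemma continuous_on_spow [continuous_intros]:
  assumes "p > 1" "continuous_on S g"
  shows "continuous_on S (\<lambda>x. spow p (g x))"
proof -
  have "isCont (spow p) y" for y
  proof (cases "y = 0")
    case False then show ?thesis using DERIV_spow DERIV_isCont by blast
  next
    case True
    have "((\<lambda>h. \<bar>h\<bar> powr (p - 1)) \<longlongrightarrow> 0) (at 0)"
      using assms by (intro tendsto_eq_intros | simp)+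
    then have "((\<lambda>h. \<bar>spow p h\<bar>) \<longlongrightarrow> 0) (at 0)" by (simp add: abs_spow)
    then have "(spow p \<longlongrightarrow> 0) (at 0)" by (rule tendsto_rabs_zero_cancel)
    then show ?thesis using True by (simp add: isCont_def)
  qed
  then have "continuous_on UNIV (spow p)" by (simp add: continuous_on_eq_continuous_at)
  from continuous_on_compose2 [OF this assms(2)] show ?thesis by simp
qed

lemma tendsto_spow:
  assumes "p > 1" "(g \<longlongrightarrow> l) F" shows "((\<lambda>x. spow p (g x)) \<longlongrightarrow> spow p l) F"
proof -
  have "continuous_on UNIV (spow p)" using continuous_on_spow [OF assms(1), of UNIV "\<lambda>x. x"] by simp
  then show ?thesis using assms(2) continuous_on_tendsto_compose [of UNIV "spow p" g l F] by simp
qed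

text \<open>
  The graph of the convex function \<open>\<bar>a\<bar>\<^sup>p\<close> lies above its tangent at \<open>b\<close>. In this form
  (with \<open>b\<close> spelled out through \<open>\<bar>b\<bar>\<^sup>p = b b\<^sup>(\<^sup>p\<^sup>-\<^sup>1\<^sup>)\<close>) it is the nonnegative term of Picone's identity.
\<close>

lemma abs_powr_above_tangent:
  assumes "p > 1"
  shows "0 \<le> \<bar>a\<bar> powr p - p * a * spow p b + (p - 1) * \<bar>b\<bar> powr p"
proof -
  define k where "k = (\<lambda>x. \<bar>x\<bar> powr p - p * x * spow p b + (p - 1) * \<bar>b\<bar> powr p)"
  have k: "(k has_real_derivative p * (spow p x - spow p b)) (at x)" for x
    unfolding k_def
    by (rule derivative_eq_intros DERIV_abs_powr [OF assms] refl)+ (simp add: algebra_simps)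
  have "k b = 0" by (simp add: k_def mult_spow [symmetric] algebra_simps)
  have "k b \<le> k a"
  proof (cases "b \<le> a")
    case True
    show ?thesis
      by (rule DERIV_nonneg_imp_nondecreasing [OF True])
         (use k spow_mono [OF assms] assms in \<open>force simp: zero_le_mult_iff\<close>)
  next
    case False
    then have "a \<le> b" by simp
    show ?thesis
      by (rule DERIV_nonpos_imp_nonincreasing [OF \<open>a \<le> b\<close>])
         (use k spow_mono [OF assms] assms in \<open>force simp: mult_le_0_iff\<close>)
  qed
  then show ?thesis using \<open>k b = 0\<close> by (simp add: k_def)
qed

section \<open>Solutions and their flux\<close>

abbreviation flux :: "real \<Rightarrow> (real \<Rightarrow> real) \<Rightarrow> real \<Rightarrow> real" where
  "flux p y \<equiv> \<lambda>t. spow p (D01 y t)"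

lemma
  assumes "C1_01 y"
  shows C1_01_DERIV_within: "x \<in> {0..1} \<Longrightarrow> (y has_real_derivative D01 y x) (at x within {0..1})"
    and C1_01_DERIV: "x \<in> {0<..<1} \<Longrightarrow> (y has_real_derivative D01 y x) (at x)"
    and C1_01_continuous: "continuous_on {0..1} y"
proof -
  show within: "(y has_real_derivative D01 y x) (at x within {0..1})" if "x \<in> {0..1}" for x
    using assms that
    by (simp add: C1_01_def differentiable_on_def D01_def has_real_derivative_iff_has_vector_derivative
        vector_derivative_works)
  show "(y has_real_derivative D01 y x) (at x)" if "x \<in> {0<..<1}"
    using within [of x] that at_within_interior [of x "{0..1}"] by simp
  show "continuous_on {0..1} y"
    using assms by (simp add: C1_01_def differentiable_imp_continuous_on)
qed

lemma D01_eqI: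
  assumes "(y has_real_derivative d) (at x within {0..1})" "x \<in> {0..1}"
  shows "D01 y x = d"
  unfolding D01_def
  using vector_derivative_within_cbox [of 0 1 x y d] assms
  by (simp add: has_real_derivative_iff_has_vector_derivative)

lemma
  assumes "regular p y" "p > 1"
  shows flux_DERIV: "x \<in> {0<..<1} \<Longrightarrow> (flux p y has_real_derivative deriv (flux p y) x) (at x)"
    and flux_continuous: "continuous_on {0..1} (flux p y)"
  using assms
  by (auto simp: regular_def C1_01_def DERIV_deriv_iff_real_differentiable intro!: continuous_on_spow)

section \<open>Picone's identity and Sturm comparison\<close>

text \<open>
  The Picone function \<open>P = u (u'\<^sup>(\<^sup>p\<^sup>-\<^sup>1\<^sup>) - (u/y)\<^sup>(\<^sup>p\<^sup>-\<^sup>1\<^sup>) y'\<^sup>(\<^sup>p\<^sup>-\<^sup>1\<^sup>))\<close> vanishes at a node, that is, at a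
  point where \<open>u\<close> is zero or the Wronskian of \<open>u\<close> and \<open>y\<close> is zero. If \<open>y(e) \<noteq> 0\<close>, then \<open>P\<close> is
  continuous at \<open>e\<close> and a zero Wronskian gives \<open>u' = (u/y) y'\<close>, which cancels the bracket. If
  \<open>y(e) = 0\<close>, then both functions vanish at \<open>e\<close> and the zero of \<open>y\<close> is simple, so \<open>u/y\<close> stays bounded
  (it tends to \<open>u'/y'\<close>) while the outer factor \<open>u\<close> tends to zero.
\<close>

lemma picone_tendsto_0:
  assumes p: "p > 1" and u: "regular p u" and y: "regular p y" and e: "e \<in> {0..1}"
    and simple: "y e \<noteq> 0 \<or> D01 y e \<noteq> 0"
    and node: "u e = 0 \<or> u e * D01 y e = y e * D01 u e"
    and S: "S \<subseteq> {0..1}" "\<And>x. x \<in> S \<Longrightarrow> y x \<noteq> 0"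
  shows "((\<lambda>x. u x * (flux p u x - spow p (u x / y x) * flux p y x)) \<longlongrightarrow> 0) (at e within S)"
proof -
  have C: "C1_01 u" "C1_01 y" using u y by (auto simp: regular_def)
  have lim: "(h \<longlongrightarrow> h e) (at e within S)" if "continuous_on {0..1} h" for h :: "real \<Rightarrow> real"
    using that e S(1) by (meson continuous_on_def tendsto_within_subset)
  have lims: "(u \<longlongrightarrow> u e) (at e within S)" "(y \<longlongrightarrow> y e) (at e within S)"
    "(flux p u \<longlongrightarrow> flux p u e) (at e within S)" "(flux p y \<longlongrightarrow> flux p y e) (at e within S)"
    using C1_01_continuous [OF C(1)] C1_01_continuous [OF C(2)] flux_continuous [OF u p]
      flux_continuous [OF y p] by (auto intro: lim)
  show ?thesis
  proof (cases "y e = 0")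
    case False
    have "((\<lambda>x. u x * (flux p u x - spow p (u x / y x) * flux p y x)) \<longlongrightarrow>
            u e * (flux p u e - spow p (u e / y e) * flux p y e)) (at e within S)"
      by (intro tendsto_intros tendsto_spow lims p False)
    moreover have "u e * (flux p u e - spow p (u e / y e) * flux p y e) = 0"
    proof (cases "u e = 0")
      case False
      then have "D01 u e = u e / y e * D01 y e" using node \<open>y e \<noteq> 0\<close> by (simp add: field_simps)
      then show ?thesis by (simp only: spow_mult) simp
    qed simp
    ultimately show ?thesis by simp
  next
    case True
    then have 0: "u e = 0" "D01 y e \<noteq> 0" using node simple by auto
    have d: "((\<lambda>x. (g x - g e) / (x - e)) \<longlongrightarrow> D01 g e) (at e within S)" if "C1_01 g" for g
      using C1_01_DERIV_within [OF that e] S(1)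
      by (auto simp: has_field_derivative_iff intro: tendsto_within_subset)
    have "((\<lambda>x. ((u x - u e) / (x - e)) / ((y x - y e) / (x - e))) \<longlongrightarrow> D01 u e / D01 y e) (at e within S)"
      by (intro tendsto_divide d C 0)
    then have q: "((\<lambda>x. u x / y x) \<longlongrightarrow> D01 u e / D01 y e) (at e within S)"
      by (rule Lim_transform_eventually) (auto simp: eventually_at_filter 0 True)
    have "((\<lambda>x. u x * (flux p u x - spow p (u x / y x) * flux p y x)) \<longlongrightarrow>
            u e * (flux p u e - spow p (D01 u e / D01 y e) * flux p y e)) (at e within S)"
      by (intro tendsto_intros tendsto_spow lims p q)
    then show ?thesis by (simp add: 0)
  qed
qed

text \<open>
  Picone's identity: where \<open>y \<noteq> 0\<close>, the derivative of the Picone function consists of the two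
  flux derivatives, weighted by \<open>u\<close> and \<open>\<bar>u\<bar>\<^sup>p / y\<^sup>(\<^sup>p\<^sup>-\<^sup>1\<^sup>)\<close>, and of the tangent-line defect of \<open>\<bar>\<cdot>\<bar>\<^sup>p\<close>
  between \<open>u'\<close> and \<open>b = u y' / y\<close>. The function \<open>u\<close> may change sign.
\<close>

lemma picone_DERIV:
  assumes p: "p > 1" and u: "regular p u" and y: "regular p y"
    and x: "x \<in> {0<..<1}" and nz: "y x \<noteq> 0"
  shows "\<exists>r\<ge>0. ((\<lambda>x. u x * (flux p u x - spow p (u x / y x) * flux p y x)) has_real_derivative
           u x * deriv (flux p u) x - \<bar>u x\<bar> powr p * deriv (flux p y) x / spow p (y x) + r) (at x)"
proof -
  have C: "C1_01 u" "C1_01 y" using u y by (auto simp: regular_def)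
  define b where "b = u x * D01 y x / y x"
  define r where "r = \<bar>D01 u x\<bar> powr p - p * D01 u x * spow p b + (p - 1) * \<bar>b\<bar> powr p"
  have "r \<ge> 0" unfolding r_def by (rule abs_powr_above_tangent [OF p])
  have eq: "(\<lambda>x. u x * (flux p u x - spow p (u x / y x) * flux p y x)) =
     (\<lambda>x. u x * flux p u x - \<bar>u x\<bar> powr p * flux p y x / spow p (y x))"
    by (rule ext) (simp add: spow_divide mult_spow [symmetric] right_diff_distrib)
  have du: "((\<lambda>x. \<bar>u x\<bar> powr p) has_real_derivative p * spow p (u x) * D01 u x) (at x)"
    by (rule DERIV_chain2 [OF DERIV_abs_powr [OF p] C1_01_DERIV [OF C(1) x]])
  have dy: "((\<lambda>x. spow p (y x)) has_real_derivative (p - 1) * spow p (y x) / y x * D01 y x) (at x)"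
    by (rule DERIV_chain2 [OF DERIV_spow [OF nz] C1_01_DERIV [OF C(2) x]])
  have D: "((\<lambda>x. u x * flux p u x - \<bar>u x\<bar> powr p * flux p y x / spow p (y x)) has_real_derivative
     (D01 u x * flux p u x + deriv (flux p u) x * u x) -
     (((p * spow p (u x) * D01 u x) * flux p y x + deriv (flux p y) x * \<bar>u x\<bar> powr p) * spow p (y x)
       - (\<bar>u x\<bar> powr p * flux p y x) * ((p - 1) * spow p (y x) / y x * D01 y x)) / (spow p (y x) * spow p (y x))) (at x)"
    by (intro DERIV_diff DERIV_divide DERIV_mult du dy C1_01_DERIV [OF C(1) x] flux_DERIV [OF u p x]
        flux_DERIV [OF y p x]) (use nz in simp)
  have b1: "spow p b = spow p (u x) * flux p y x / spow p (y x)"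
    by (simp add: b_def spow_mult spow_divide)
  have b2: "\<bar>b\<bar> powr p = (\<bar>u x\<bar> powr p * flux p y x) * D01 y x / (y x * spow p (y x))"
    unfolding mult_spow [symmetric] b1 by (simp add: b_def)
  have "(D01 u x * flux p u x + deriv (flux p u) x * u x) -
     (((p * spow p (u x) * D01 u x) * flux p y x + deriv (flux p y) x * \<bar>u x\<bar> powr p) * spow p (y x)
       - (\<bar>u x\<bar> powr p * flux p y x) * ((p - 1) * spow p (y x) / y x * D01 y x)) / (spow p (y x) * spow p (y x))
     = u x * deriv (flux p u) x - \<bar>u x\<bar> powr p * deriv (flux p y) x / spow p (y x) + r"
    unfolding r_def b1 b2 using nz by (simp add: mult_spow [of "D01 u x", symmetric] field_simps)
  with D have "((\<lambda>x. u x * flux p u x - \<bar>u x\<bar> powr p * flux p y x / spow p (y x)) has_real_derivative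
     u x * deriv (flux p u) x - \<bar>u x\<bar> powr p * deriv (flux p y) x / spow p (y x) + r) (at x)"
    by (simp only:)
  then show ?thesis unfolding eq using \<open>r \<ge> 0\<close> by blast
qed

text \<open>
  If \<open>y\<close> had no zero between two nodes, the Picone function would be nondecreasing there with limit
  \<open>0\<close> at both ends, hence constantly \<open>0\<close>; but its derivative is positive wherever \<open>u \<noteq> 0\<close>.
\<close>

lemma zero_between_nodes:
  assumes p: "p > 1" and u: "regular p u" and y: "regular p y"
    and ab: "a < b" "a \<in> {0..1}" "b \<in> {0..1}"
    and simple: "\<And>e. e \<in> {0..1} \<Longrightarrow> y e \<noteq> 0 \<or> D01 y e \<noteq> 0"
    and node: "\<And>e. e \<in> {a, b} \<Longrightarrow> u e = 0 \<or> u e * D01 y e = y e * D01 u e"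
    and z: "z \<in> {a<..<b}" "u z \<noteq> 0"
    and less: "\<And>x. x \<in> {0<..<1} \<Longrightarrow> u x \<noteq> 0 \<Longrightarrow> y x \<noteq> 0 \<Longrightarrow>
       \<bar>u x\<bar> powr p * deriv (flux p y) x / spow p (y x) < u x * deriv (flux p u) x"
  shows "\<exists>x\<in>{a<..<b}. y x = 0"
proof (rule ccontr)
  assume "\<not> ?thesis"
  then have nz: "\<And>x. x \<in> {a<..<b} \<Longrightarrow> y x \<noteq> 0" by auto
  define P where "P = (\<lambda>x. u x * (flux p u x - spow p (u x / y x) * flux p y x))"
  \<comment> \<open>The continuous extension of the Picone function by its limits at the two ends.\<close>
  define Q where "Q = (\<lambda>x. if x \<in> {a<..<b} then P x else 0)"
  have sub: "{a<..<b} \<subseteq> {0<..<1}" "{a<..<b} \<subseteq> {0..1}" using ab by auto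
  have P': "\<exists>d. (P has_real_derivative d) (at x) \<and> 0 \<le> d \<and> (u x \<noteq> 0 \<longrightarrow> 0 < d)"
    if x: "x \<in> {a<..<b}" for x
  proof -
    have x1: "x \<in> {0<..<1}" using sub x by auto
    obtain r where "r \<ge> 0" and r: "(P has_real_derivative
       u x * deriv (flux p u) x - \<bar>u x\<bar> powr p * deriv (flux p y) x / spow p (y x) + r) (at x)"
      using picone_DERIV [OF p u y x1 nz [OF x]] unfolding P_def by auto
    show ?thesis
      using r \<open>r \<ge> 0\<close> less [OF x1 _ nz [OF x]] p by (cases "u x = 0") (force+)
  qed
  have Q': "(Q has_real_derivative d) (at x)"
    if "x \<in> {a<..<b}" "(P has_real_derivative d) (at x)" for x d
    by (rule has_field_derivative_transform_within_open [OF that(2), of "{a<..<b}"])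
       (use that in \<open>auto simp: Q_def\<close>)
  have lim: "(Q \<longlongrightarrow> 0) (at e within {a<..<b})" if "e \<in> {a, b}" for e
  proof -
    have "(P \<longlongrightarrow> 0) (at e within {a<..<b})"
      unfolding P_def
      by (rule picone_tendsto_0 [OF p u y _ _ node [OF that]]) (use that ab simple nz sub in auto)
    then show ?thesis
      by (rule Lim_transform_eventually) (auto simp: eventually_at_filter Q_def)
  qed
  have contQ: "continuous_on {a..b} Q"
    unfolding continuous_on_def
  proof
    fix x assume "x \<in> {a..b}"
    then consider "x \<in> {a<..<b}" | "x \<in> {a, b}" by fastforce
    then show "(Q \<longlongrightarrow> Q x) (at x within {a..b})"
    proof cases
      case 1
      then obtain d where "(P has_real_derivative d) (at x)" using P' by blast
      then show ?thesis using Q' [OF 1] DERIV_isCont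
        by (metis continuous_within isCont_def tendsto_within_subset top_greatest)
    next
      case 2
      have "(Q \<longlongrightarrow> 0) (at x within {a..b})"
      proof (rule Lim_transform_within_set [OF lim [OF 2]])
        show "\<forall>\<^sub>F t in at x. (t \<in> {a<..<b}) = (t \<in> {a..b})"
          using eventually_at_in_open' 2 ab
          by (auto simp: eventually_at intro!: exI [of _ "b - a"] simp: dist_real_def)
      qed
      then show ?thesis using 2 by (auto simp: Q_def)
    qed
  qed
  have mono: "Q c \<le> Q d" if "a \<le> c" "c \<le> d" "d \<le> b" for c d
  proof (cases "c = d")
    case False
    show ?thesis
    proof (rule DERIV_nonneg_imp_increasing_open [of c d Q])
      show "\<exists>k. (Q has_real_derivative k) (at x) \<and> 0 \<le> k" if "c < x" "x < d" for x
        using P' [of x] Q' [of x] that \<open>a \<le> c\<close> \<open>d \<le> b\<close> by force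
      show "continuous_on {c..d} Q" by (rule continuous_on_subset [OF contQ]) (use that in auto)
    qed (use that in auto)
  qed simp
  have Q0: "Q x = 0" if "x \<in> {a<..<b}" for x
    using mono [of a x] mono [of x b] that by (auto simp: Q_def)
  obtain d where d: "(P has_real_derivative d) (at z)" "0 < d" using P' [OF z(1)] z(2) by auto
  have "(Q has_real_derivative d) (at z)" by (rule Q' [OF z(1) d(1)])
  moreover have "(Q has_real_derivative 0) (at z)"
    by (rule has_field_derivative_transform_within_open [of "\<lambda>_. 0" _ _ "{a<..<b}"])
       (use Q0 z in auto)
  ultimately show False using d(2) DERIV_unique by blast
qed

text \<open>
  Each node except the last is sent to a zero of \<open>y\<close> in the gap between it and the next node. The
  gaps are disjoint, so this map is injective. Since \<open>E\<close> may be any finite set of nodes, the lemma applies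
  before the zeros of \<open>u\<close> are known to be finitely many.
\<close>

lemma zeros_separate_nodes:
  assumes p: "p > 1" and u: "regular p u" and y: "regular p y"
    and simple_y: "\<And>e. e \<in> {0..1} \<Longrightarrow> y e \<noteq> 0 \<or> D01 y e \<noteq> 0"
    and simple_u: "\<And>e. e \<in> {0..1} \<Longrightarrow> u e \<noteq> 0 \<or> D01 u e \<noteq> 0"
    and less: "\<And>x. x \<in> {0<..<1} \<Longrightarrow> u x \<noteq> 0 \<Longrightarrow> y x \<noteq> 0 \<Longrightarrow>
       \<bar>u x\<bar> powr p * deriv (flux p y) x / spow p (y x) < u x * deriv (flux p u) x"
    and E: "finite E" "E \<subseteq> {0..1}"
    and node: "\<And>e. e \<in> E \<Longrightarrow> u e = 0 \<or> u e * D01 y e = y e * D01 u e"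
  shows "\<exists>Y \<subseteq> {x \<in> {0<..<1}. y x = 0}. finite Y \<and> card Y = card E - 1"
proof (cases "E = {}")
  case False
  have C: "C1_01 u" using u by (auto simp: regular_def)
  \<comment> \<open>The next node to the right; it exists for every node except the largest.\<close>
  define nxt where "nxt = (\<lambda>x. Min {t \<in> E. x < t})"
  define A where "A = E - {Max E}"
  have nxt: "nxt x \<in> E" "x < nxt x" "\<And>t. t \<in> E \<Longrightarrow> x < t \<Longrightarrow> nxt x \<le> t" if "x \<in> A" for x
  proof -
    have "x \<in> E" "x \<noteq> Max E" using that by (auto simp: A_def)
    then have "x < Max E" using Max_ge [OF E(1), of x] by linarith
    then have ne: "{t \<in> E. x < t} \<noteq> {}" using E(1) False Max_in by blast
    have "nxt x \<in> {t \<in> E. x < t}" unfolding nxt_def using E(1) ne by (intro Min_in) auto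
    then show "nxt x \<in> E" "x < nxt x" by auto
    show "nxt x \<le> t" if "t \<in> E" "x < t" for t unfolding nxt_def using E(1) that by simp
  qed
  have "\<exists>z\<in>{x<..<nxt x}. y z = 0" if x: "x \<in> A" for x
  proof -
    have xE: "x \<in> E" using x by (auto simp: A_def)
    have "\<exists>z\<in>{x<..<nxt x}. u z \<noteq> 0"
    proof (rule ccontr)
      assume "\<not> ?thesis"
      then have 0: "\<And>z. z \<in> {x<..<nxt x} \<Longrightarrow> u z = 0" by auto
      define m where "m = (x + nxt x) / 2"
      have m: "m \<in> {x<..<nxt x}" using nxt [OF x] by (auto simp: m_def)
      then have m1: "m \<in> {0<..<1}" using xE nxt [OF x] E(2) by fastforce
      have "(u has_real_derivative 0) (at m)"
        by (rule has_field_derivative_transform_within_open [of "\<lambda>_. 0" _ _ "{x<..<nxt x}"])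
           (use 0 m in auto)
      then have "D01 u m = 0" using C1_01_DERIV [OF C m1] DERIV_unique by blast
      then show False using simple_u [of m] 0 [OF m] m1 by auto
    qed
    then obtain z where z: "z \<in> {x<..<nxt x}" "u z \<noteq> 0" by blast
    show ?thesis
      by (rule zero_between_nodes [OF p u y nxt(2) [OF x] _ _ simple_y _ z less])
         (use xE nxt [OF x] E(2) node in auto)
  qed
  then obtain Z where Z: "\<And>x. x \<in> A \<Longrightarrow> Z x \<in> {x<..<nxt x} \<and> y (Z x) = 0" by metis
  have lt: "Z x < Z x'" if "x \<in> A" "x' \<in> A" "x < x'" for x x'
  proof -
    have "nxt x \<le> x'" using nxt(3) [OF that(1)] that by (auto simp: A_def)
    then show ?thesis using Z [OF that(1)] Z [OF that(2)] by auto
  qed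
  have "inj_on Z A"
    by (rule inj_onI) (metis lt linorder_neqE_linordered_idom order_less_irrefl)
  then have "card (Z ` A) = card E - 1"
    using E(1) False by (simp add: card_image A_def)
  moreover have "Z ` A \<subseteq> {x \<in> {0<..<1}. y x = 0}"
  proof
    fix t assume "t \<in> Z ` A"
    then obtain x where x: "x \<in> A" "t = Z x" by blast
    then have "x \<in> {0..1}" "nxt x \<in> {0..1}" using nxt(1) [OF x(1)] E(2) by (auto simp: A_def)
    then show "t \<in> {x \<in> {0<..<1}. y x = 0}" using Z [OF x(1)] x(2) by auto
  qed
  ultimately show ?thesis using E(1) by (intro exI [of _ "Z ` A"]) (auto simp: A_def)
next
  case True
  then show ?thesis by (intro exI [of _ "{}"]) simp
qed

section \<open>Zeros of solutions are simple\<close>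

definition solves ::
  "real \<Rightarrow> (real \<Rightarrow> real) \<Rightarrow> (real \<Rightarrow> real) \<Rightarrow> (real \<Rightarrow> real) \<Rightarrow> (real \<Rightarrow> real) \<Rightarrow> bool" where
  "solves p q w f y \<longleftrightarrow> regular p y \<and>
    (\<forall>x\<in>{0<..<1}. deriv (flux p y) x = (p - 1) * (q x * spow p (y x) - w x * f (y x)))"

text \<open>
  An eigenfunction is a nontrivial solution of the boundary value problem with \<open>f(s) = l s\<^sup>(\<^sup>p\<^sup>-\<^sup>1\<^sup>)\<close>, so
  both kinds of functions can be compared as solutions of the same equation with different \<open>f\<close>.
\<close>

lemma bvp_solution_iff:
  "bvp_solution p \<alpha> \<beta> q w f y \<longleftrightarrow> solves p q w f y \<and> boundary_conditions p \<alpha> \<beta> y"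
  unfolding bvp_solution_def solves_def by (auto simp: algebra_simps)

lemma eigenfunction_iff:
  "eigenfunction p \<alpha> \<beta> q w l y \<longleftrightarrow>
    nontrivial y \<and> solves p q w (\<lambda>s. l * spow p s) y \<and> boundary_conditions p \<alpha> \<beta> y"
  unfolding eigenfunction_def solves_def by (auto simp: algebra_simps)

lemma mean_value_segment:
  fixes g g' :: "real \<Rightarrow> real"
  assumes "a \<in> {0..1}" "b \<in> {0..1}" "a \<noteq> b" "continuous_on {0..1} g"
    and g': "\<And>x. x \<in> {0<..<1} \<Longrightarrow> (g has_real_derivative g' x) (at x)"
  shows "\<exists>c\<in>open_segment a b. g b - g a = g' c * (b - a)"
proof -
  have lt: "\<exists>c\<in>{a<..<b}. g b - g a = g' c * (b - a)"
    if ab: "a \<in> {0..1}" "b \<in> {0..1}" "a < b" for a b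
  proof -
    have "continuous_on {a..b} g" by (rule continuous_on_subset [OF assms(4)]) (use ab in auto)
    then obtain c where "a < c" "c < b" "g b - g a = g' c * (b - a)"
      using mvt [OF ab(3), of g "\<lambda>x. (*) (g' x)"] g' ab
      unfolding has_field_derivative_def by (metis atLeastAtMost_iff greaterThanLessThan_iff le_less_trans less_le_trans)
    then show ?thesis by auto
  qed
  show ?thesis
  proof (cases "a < b")
    case True
    then show ?thesis using lt [of a b] assms by (simp add: open_segment_eq_real_ivl)
  next
    case False
    then obtain c where "c \<in> {b<..<a}" "g a - g b = g' c * (a - b)" using lt [of b a] assms by auto
    then show ?thesis
      using False by (intro bexI [of _ c]) (auto simp: open_segment_eq_real_ivl algebra_simps)
  qed
qed

text \<open>
  At a double zero the mean value theorem applies twice, to \<open>y\<close> and then to its flux. Only the value of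
  the flux derivative at one intermediate point \<open>\<eta>\<close> remains, and its sign is that of \<open>y(x)\<close> on either
  side of \<open>x0\<close>, because the increments \<open>x - x0\<close> and \<open>\<xi> - x0\<close> have the same sign.
\<close>

lemma double_mean_value:
  assumes p: "p > 1" and y: "regular p y" and x: "x0 \<in> {0..1}" "x \<in> {0..1}" "x \<noteq> x0"
    and 0: "y x0 = 0" "D01 y x0 = 0"
  shows "\<exists>\<eta>\<in>open_segment x0 x. sgn (y x) = sgn (deriv (flux p y) \<eta>) \<and>
           \<bar>y x\<bar> \<le> \<bar>deriv (flux p y) \<eta>\<bar> powr (1 / (p - 1)) * \<bar>x - x0\<bar>"
proof -
  have C: "C1_01 y" using y by (auto simp: regular_def)
  define p' where "p' = p / (p - 1)"
  have p': "p' - 1 = 1 / (p - 1)" using p by (simp add: p'_def field_simps)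
  obtain \<xi> where \<xi>: "\<xi> \<in> open_segment x0 x" "y x = D01 y \<xi> * (x - x0)"
    using mean_value_segment [OF x(1,2) x(3) [symmetric] C1_01_continuous [OF C] C1_01_DERIV [OF C]] 0
    by auto
  have seg: "open_segment x0 \<xi> \<subseteq> open_segment x0 x" "\<xi> \<noteq> x0" "\<xi> \<in> {0..1}"
    "\<bar>\<xi> - x0\<bar> \<le> 1" "sgn (\<xi> - x0) = sgn (x - x0)"
    using \<xi>(1) x by (auto simp: open_segment_eq_real_ivl split: if_splits)
  obtain \<eta> where \<eta>: "\<eta> \<in> open_segment x0 \<xi>" "flux p y \<xi> = deriv (flux p y) \<eta> * (\<xi> - x0)"
    using mean_value_segment [OF x(1) seg(3) seg(2) [symmetric] flux_continuous [OF y p] flux_DERIV [OF y p]] 0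
    by auto
  have "D01 y \<xi> = spow p' (deriv (flux p y) \<eta> * (\<xi> - x0))"
    using \<eta>(2) spow_inverse' [OF p, of "D01 y \<xi>"] by (simp add: p'_def)
  then have eq: "y x = spow p' (deriv (flux p y) \<eta>) * spow p' (\<xi> - x0) * (x - x0)"
    using \<xi>(2) by (simp add: spow_mult)
  have "sgn (y x) = sgn (deriv (flux p y) \<eta>)"
    unfolding eq using seg x(3) by (simp add: sgn_mult)
  moreover have "\<bar>y x\<bar> \<le> \<bar>deriv (flux p y) \<eta>\<bar> powr (1 / (p - 1)) * \<bar>x - x0\<bar>"
  proof -
    have "\<bar>\<xi> - x0\<bar> powr (1 / (p - 1)) \<le> 1" using seg p by (intro powr_le1) auto
    then show ?thesis
      unfolding eq abs_mult abs_spow p' by (intro mult_right_mono) (auto simp: mult_left_le)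
  qed
  ultimately show ?thesis using \<eta>(1) seg(1) by auto
qed

text \<open>
  Evaluated at a maximum point of \<open>\<bar>y\<bar>\<close>, the double mean value estimate bounds the maximum by itself
  times a factor below \<open>1\<close>. The bound on the flux derivative is required only in the direction
  \<open>sgn (y x)\<close>, which is what a solution still satisfies if \<open>f(s)/s\<^sup>p\<^sup>-\<^sup>1\<close> is positive but unbounded.
\<close>

lemma vanishes_near_double_zero:
  assumes p: "p > 1" and y: "regular p y" and x0: "x0 \<in> {0..1}" and 0: "y x0 = 0" "D01 y x0 = 0"
    and C: "C \<ge> 0" and \<delta>: "\<delta> > 0" "C powr (1 / (p - 1)) * \<delta> < 1"
    and bound: "\<And>x \<eta>. x \<in> {0..1} \<Longrightarrow> \<bar>x - x0\<bar> \<le> \<delta> \<Longrightarrow> \<eta> \<in> open_segment x0 x \<Longrightarrow> y x \<noteq> 0 \<Longrightarrow>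
        sgn (y x) * deriv (flux p y) \<eta> \<le> C * \<bar>y \<eta>\<bar> powr (p - 1)"
    and x: "x \<in> {0..1}" "\<bar>x - x0\<bar> \<le> \<delta>"
  shows "y x = 0"
proof -
  have C1: "C1_01 y" using y by (auto simp: regular_def)
  define S where "S = {0..1} \<inter> cball x0 \<delta>"
  have "compact S" "S \<noteq> {}" "x \<in> S"
    using x0 \<delta> x by (auto simp: S_def dist_real_def intro!: compact_Int)
  moreover have "continuous_on S (\<lambda>x. \<bar>y x\<bar>)"
    by (intro continuous_intros continuous_on_subset [OF C1_01_continuous [OF C1]]) (auto simp: S_def)
  ultimately obtain m where m: "m \<in> S" "\<And>t. t \<in> S \<Longrightarrow> \<bar>y t\<bar> \<le> \<bar>y m\<bar>"
    using continuous_attains_sup by meson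
  have "y m = 0"
  proof (rule ccontr)
    assume nz: "y m \<noteq> 0"
    then have "m \<noteq> x0" using 0 by auto
    have mS: "m \<in> {0..1}" "\<bar>m - x0\<bar> \<le> \<delta>" using m(1) by (auto simp: S_def dist_real_def)
    obtain \<eta> where \<eta>: "\<eta> \<in> open_segment x0 m" "sgn (y m) = sgn (deriv (flux p y) \<eta>)"
      "\<bar>y m\<bar> \<le> \<bar>deriv (flux p y) \<eta>\<bar> powr (1 / (p - 1)) * \<bar>m - x0\<bar>"
      using double_mean_value [OF p y x0 mS(1) \<open>m \<noteq> x0\<close> 0] by blast
    have "\<eta> \<in> S"
      using \<eta>(1) mS x0 by (auto simp: S_def dist_real_def open_segment_eq_real_ivl split: if_splits)
    have "\<bar>deriv (flux p y) \<eta>\<bar> \<le> C * \<bar>y \<eta>\<bar> powr (p - 1)"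
      using bound [OF mS \<eta>(1) nz] unfolding \<eta>(2) by (simp add: abs_sgn mult.commute)
    also have "\<dots> \<le> C * \<bar>y m\<bar> powr (p - 1)"
      using m(2) [OF \<open>\<eta> \<in> S\<close>] p C by (intro mult_left_mono powr_mono2) auto
    finally have "\<bar>deriv (flux p y) \<eta>\<bar> powr (1 / (p - 1)) \<le> (C * \<bar>y m\<bar> powr (p - 1)) powr (1 / (p - 1))"
      using p by (intro powr_mono2) auto
    also have "\<dots> = C powr (1 / (p - 1)) * \<bar>y m\<bar>"
      using p C nz by (simp add: powr_mult powr_powr)
    finally have "\<bar>y m\<bar> \<le> C powr (1 / (p - 1)) * \<bar>y m\<bar> * \<bar>m - x0\<bar>"
      using \<eta>(3) by (meson abs_ge_zero mult_right_mono order_trans)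
    also have "\<dots> \<le> C powr (1 / (p - 1)) * \<bar>y m\<bar> * \<delta>"
      using mS(2) by (intro mult_left_mono) auto
    also have "\<dots> = (C powr (1 / (p - 1)) * \<delta>) * \<bar>y m\<bar>" by simp
    also have "\<dots> < 1 * \<bar>y m\<bar>" using \<delta> nz by (intro mult_strict_right_mono) auto
    finally show False by simp
  qed
  then show ?thesis using m(2) [OF \<open>x \<in> S\<close>] by simp
qed

lemma exists_small_step:
  fixes C a :: real shows "\<exists>\<delta>>0. C powr a * \<delta> < 1"
  by (rule exI [of _ "1 / (C powr a + 1)"]) (auto simp: field_simps add_pos_nonneg add_nonneg_pos)

text \<open>
  Two-sided bound: the step \<open>\<delta>\<close> on which a double zero spreads is uniform, so finitely many steps
  cover \<open>[0,1]\<close> and the solution is trivial.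
\<close>

lemma simple_zeros_if_bounded:
  assumes p: "p > 1" and y: "regular p y" and nt: "nontrivial y"
    and C: "C \<ge> 0" and bound: "\<And>x. x \<in> {0<..<1} \<Longrightarrow> \<bar>deriv (flux p y) x\<bar> \<le> C * \<bar>y x\<bar> powr (p - 1)"
    and e: "e \<in> {0..1}"
  shows "y e \<noteq> 0 \<or> D01 y e \<noteq> 0"
proof (rule ccontr)
  assume "\<not> ?thesis"
  then have 0: "y e = 0" "D01 y e = 0" by auto
  have C1: "C1_01 y" using y by (auto simp: regular_def)
  obtain \<delta> where \<delta>: "\<delta> > 0" "C powr (1 / (p - 1)) * \<delta> < 1" using exists_small_step by blast
  have near: "y x = 0"
    if "x0 \<in> {0..1}" "y x0 = 0" "D01 y x0 = 0" "x \<in> {0..1}" "\<bar>x - x0\<bar> \<le> \<delta>" for x0 x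
  proof (rule vanishes_near_double_zero [OF p y that(1,2,3) C \<delta> _ that(4,5)])
    fix x \<eta> assume "x \<in> {0..1}" "\<eta> \<in> open_segment x0 x"
    then have "\<eta> \<in> {0<..<1}"
      using that(1) by (auto simp: open_segment_eq_real_ivl split: if_splits)
    moreover have "sgn (y x) * deriv (flux p y) \<eta> \<le> \<bar>deriv (flux p y) \<eta>\<bar>"
      by (auto simp: sgn_if)
    ultimately show "sgn (y x) * deriv (flux p y) \<eta> \<le> C * \<bar>y \<eta>\<bar> powr (p - 1)"
      using bound by fastforce
  qed
  have near': "D01 y x = 0"
    if "x0 \<in> {0..1}" "y x0 = 0" "D01 y x0 = 0" "x \<in> {0..1}" "\<bar>x - x0\<bar> < \<delta>" for x0 x
  proof -
    have "y t = 0" if "t \<in> {0..1}" "dist t x < \<delta> - \<bar>x - x0\<bar>" for t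
      by (rule near [of x0]) (use \<open>x0 \<in> {0..1}\<close> \<open>y x0 = 0\<close> \<open>D01 y x0 = 0\<close> that in \<open>auto simp: dist_real_def\<close>)
    note 0 = this
    have "(y has_real_derivative 0) (at x within {0..1})"
      by (rule has_field_derivative_transform_within [of "\<lambda>_. 0" _ _ _ "\<delta> - \<bar>x - x0\<bar>"])
         (use that(4,5) 0 in auto)
    then show ?thesis by (rule D01_eqI [OF _ that(4)])
  qed
  have all: "\<forall>x\<in>{0..1}. \<bar>x - e\<bar> \<le> k * (\<delta> / 2) \<longrightarrow> y x = 0 \<and> D01 y x = 0" for k :: nat
  proof (induction k)
    case 0
    then show ?case using \<open>y e = 0\<close> \<open>D01 y e = 0\<close> by auto
  next
    case (Suc k)
    show ?case
    proof (intro ballI impI)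
      fix x :: real assume x: "x \<in> {0..1}" "\<bar>x - e\<bar> \<le> real (Suc k) * (\<delta> / 2)"
      define x' where "x' = e + (x - e) * (k / Suc k)"
      have d1: "x' - e = (x - e) * (k / Suc k)" and d2: "x - x' = (x - e) * (1 / Suc k)"
        by (simp_all add: x'_def field_simps)
      have "x' = (1 - k / Suc k) *\<^sub>R e + (k / Suc k) *\<^sub>R x" by (simp add: x'_def algebra_simps diff_divide_distrib)
      then have "x' \<in> {0..1}"
        using convexD_alt [OF _ e x(1), of "k / Suc k"] by simp
      moreover have "\<bar>x' - e\<bar> \<le> k * (\<delta> / 2)"
      proof -
        have "\<bar>x' - e\<bar> = \<bar>x - e\<bar> * (k / Suc k)" unfolding d1 abs_mult by simp
        also have "\<dots> \<le> real (Suc k) * (\<delta> / 2) * (k / Suc k)" by (rule mult_right_mono [OF x(2)]) simp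
        also have "\<dots> = k * (\<delta> / 2)" by (simp del: of_nat_Suc)
        finally show ?thesis .
      qed
      ultimately have "y x' = 0" "D01 y x' = 0" using Suc by auto
      moreover have "\<bar>x - x'\<bar> \<le> \<delta> / 2"
      proof -
        have "\<bar>x - x'\<bar> = \<bar>x - e\<bar> * (1 / Suc k)" unfolding d2 abs_mult by simp
        also have "\<dots> \<le> real (Suc k) * (\<delta> / 2) * (1 / Suc k)" by (rule mult_right_mono [OF x(2)]) simp
        also have "\<dots> = \<delta> / 2" by (simp del: of_nat_Suc)
        finally show ?thesis .
      qed
      ultimately show "y x = 0 \<and> D01 y x = 0"
        using near [of x' x] near' [of x' x] \<open>x' \<in> {0..1}\<close> x \<delta>(1) by auto
    qed
  qed
  obtain k :: nat where "1 / (\<delta> / 2) \<le> k" using real_arch_simple by blast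
  then have "1 \<le> k * (\<delta> / 2)" using \<delta>(1) by (simp add: field_simps)
  then have "y x = 0" if "x \<in> {0..1}" for x
    using all [of k] that e by (smt (verit) atLeastAtMost_iff)
  then show False using nt by (auto simp: nontrivial_def)
qed

text \<open>
  One-sided bound: near \<open>e\<close> the finitely many zeros leave \<open>y\<close> with a constant sign on each side, so
  the one-sided bound suffices to make \<open>y\<close> vanish on an interval, which contradicts finiteness.
\<close>

lemma simple_zeros_if_finite:
  assumes p: "p > 1" and y: "regular p y" and fin: "finite {x \<in> {0<..<1}. y x = 0}"
    and C: "C \<ge> 0"
    and bound: "\<And>x. x \<in> {0<..<1} \<Longrightarrow> sgn (y x) * deriv (flux p y) x \<le> C * \<bar>y x\<bar> powr (p - 1)"
    and e: "e \<in> {0..1}"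
  shows "y e \<noteq> 0 \<or> D01 y e \<noteq> 0"
proof (rule ccontr)
  assume "\<not> ?thesis"
  then have 0: "y e = 0" "D01 y e = 0" by auto
  have C1: "C1_01 y" using y by (auto simp: regular_def)
  obtain \<delta>0 where \<delta>0: "\<delta>0 > 0" "C powr (1 / (p - 1)) * \<delta>0 < 1" using exists_small_step by blast
  obtain d where d: "d > 0" "\<And>x. x \<in> {x \<in> {0<..<1}. y x = 0} \<Longrightarrow> x \<noteq> e \<Longrightarrow> d \<le> dist e x"
    using finite_set_avoid [OF fin, of e] by blast
  define \<delta> where "\<delta> = min (\<delta>0) (d / 2)"
  have "C powr (1 / (p - 1)) * \<delta> \<le> C powr (1 / (p - 1)) * \<delta>0"
    by (intro mult_left_mono) (auto simp: \<delta>_def)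
  then have \<delta>: "\<delta> > 0" "C powr (1 / (p - 1)) * \<delta> < 1" "\<delta> < d" using \<delta>0 d by (auto simp: \<delta>_def)
  have near: "y x = 0" if "x \<in> {0..1}" "\<bar>x - e\<bar> \<le> \<delta>" for x
  proof (rule vanishes_near_double_zero [OF p y e 0 C \<delta>(1,2) _ that])
    fix x \<eta> assume x: "x \<in> {0..1}" "\<bar>x - e\<bar> \<le> \<delta>" "\<eta> \<in> open_segment e x" "y x \<noteq> 0"
    then have \<eta>: "\<eta> \<in> {0<..<1}"
      using e by (auto simp: open_segment_eq_real_ivl split: if_splits)
    have nz: "y t \<noteq> 0" if "t \<in> closed_segment \<eta> x" for t
    proof (cases "t = x")
      case False
      then have "t \<in> {0<..<1}" "t \<noteq> e" "dist e t < d"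
        using that x e \<delta> by (auto simp: open_segment_eq_real_ivl closed_segment_eq_real_ivl dist_real_def split: if_splits)
      then show ?thesis using d(2) [of t] by force
    qed (use x in auto)
    have sub: "closed_segment \<eta> x \<subseteq> {0..1}"
      using x \<eta> by (auto simp: closed_segment_eq_real_ivl)
    have "sgn (y \<eta>) = sgn (y x)"
    proof (rule ccontr)
      assume *: "sgn (y \<eta>) \<noteq> sgn (y x)"
      have "connected (y ` closed_segment \<eta> x)"
        by (intro connected_continuous_image continuous_on_subset [OF C1_01_continuous [OF C1] sub]) auto
      moreover have "y \<eta> \<in> y ` closed_segment \<eta> x" "y x \<in> y ` closed_segment \<eta> x" by auto
      ultimately have "0 \<in> y ` closed_segment \<eta> x"
        using * nz [of \<eta>] nz [of x] connected_contains_Icc [of _ "y \<eta>" "y x"]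
          connected_contains_Icc [of _ "y x" "y \<eta>"]
        by (force simp: sgn_if split: if_splits)
      then show False using nz by auto
    qed
    then show "sgn (y x) * deriv (flux p y) \<eta> \<le> C * \<bar>y \<eta>\<bar> powr (p - 1)"
      using bound [OF \<eta>] by simp
  qed
  define I where "I = {max 0 (e - \<delta>)<..<min 1 (e + \<delta>)}"
  have "I \<subseteq> {x \<in> {0<..<1}. y x = 0}" using near by (auto simp: I_def)
  moreover have "infinite I" unfolding I_def using e \<delta> by (intro infinite_Ioo) auto
  ultimately show False using fin finite_subset by blast
qed

section \<open>Scalar initial value problems on the unit interval\<close>

text \<open>
  Picard's theorem by a single application of Banach's fixed point theorem. Writing the unknown as
  \<open>exp (2 L x) \<psi>(x)\<close> makes the integral operator a contraction with constant \<open>1/2\<close> on the whole interval,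
  so no patching of short intervals is needed. Since bounded continuous functions live on the whole
  real line, the functions that the operator produces are composed with the projection \<open>k\<close> onto \<open>[0,1]\<close>.
\<close>

lemma picard_unit_interval:
  fixes F :: "real \<Rightarrow> real \<Rightarrow> real"
  assumes cont: "continuous_on ({0..1} \<times> UNIV) (\<lambda>(t, z). F t z)" and L: "L > 0"
    and lip: "\<And>t z z'. t \<in> {0..1} \<Longrightarrow> \<bar>F t z - F t z'\<bar> \<le> L * \<bar>z - z'\<bar>"
  shows "\<exists>\<theta>. \<theta> 0 = c \<and> (\<forall>x\<in>{0..1}. (\<theta> has_real_derivative F x (\<theta> x)) (at x within {0..1}))"
proof -
  define k where "k = (\<lambda>x::real. max 0 (min 1 x))"
  have k: "k x \<in> {0..1}" for x by (auto simp: k_def)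
  have kid: "k x = x" if "x \<in> {0..1}" for x using that by (auto simp: k_def)
  define g where "g = (\<lambda>(\<psi> :: real \<Rightarrow>\<^sub>C real) t. F t (exp (2 * L * t) * \<psi> t))"
  define G where "G = (\<lambda>\<psi> x. exp (- (2 * L * x)) * (c + integral {0..x} (g \<psi>)))"
  have cg: "continuous_on {0..1} (g \<psi>)" for \<psi>
  proof -
    have "continuous_on {0..1} (\<lambda>t. (t, exp (2 * L * t) * \<psi> t))"
      by (intro continuous_intros continuous_on_apply_bcontfun)
    then have "continuous_on {0..1} (\<lambda>t. case (t, exp (2 * L * t) * \<psi> t) of (t, z) \<Rightarrow> F t z)"
      by (rule continuous_on_compose2 [OF cont]) auto
    then show ?thesis by (simp add: g_def)
  qed
  have ig: "g \<psi> integrable_on {0..x}" if "x \<in> {0..1}" for \<psi> x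
    by (rule integrable_continuous_real, rule continuous_on_subset [OF cg]) (use that in auto)
  have cG: "continuous_on {0..1} (G \<psi>)" for \<psi>
    unfolding G_def by (intro continuous_intros indefinite_integral_continuous_1 ig) auto
  have mem: "(\<lambda>x. G \<psi> (k x)) \<in> bcontfun" for \<psi>
  proof -
    have "continuous_on UNIV (\<lambda>x. G \<psi> (k x))"
      by (rule continuous_on_compose2 [OF cG]) (use k in \<open>auto simp: k_def intro!: continuous_intros\<close>)
    moreover have "bounded (G \<psi> ` {0..1})"
      by (intro compact_imp_bounded compact_continuous_image cG) auto
    then have "bounded (range (\<lambda>x. G \<psi> (k x)))"
      by (rule bounded_subset) (use k in auto)
    ultimately show ?thesis by (simp add: bcontfun_def)
  qed
  define T where "T = (\<lambda>\<psi>. Bcontfun (\<lambda>x. G \<psi> (k x)))"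
  have T: "T \<psi> x = G \<psi> (k x)" for \<psi> x
    unfolding T_def using mem by (simp add: Bcontfun_inverse)
  have "dist (T \<psi>) (T \<phi>) \<le> 1 / 2 * dist \<psi> \<phi>" for \<psi> \<phi>
  proof (rule dist_bound)
    fix x
    define D where "D = dist \<psi> \<phi>"
    define s where "s = k x"
    have s: "s \<in> {0..1}" using k by (simp add: s_def)
    have E: "((\<lambda>t. L * exp (2 * L * t) * D) has_integral (exp (2 * L * s) * D / 2 - exp (2 * L * 0) * D / 2)) {0..s}"
      using s L by (intro fundamental_theorem_of_calculus)
        (auto intro!: derivative_eq_intros simp: has_real_derivative_iff_has_vector_derivative [symmetric])
    have "\<bar>integral {0..s} (\<lambda>t. g \<psi> t - g \<phi> t)\<bar> \<le> integral {0..s} (\<lambda>t. L * exp (2 * L * t) * D)"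
      unfolding real_norm_def [symmetric]
    proof (rule integral_norm_bound_integral)
      show "(\<lambda>t. g \<psi> t - g \<phi> t) integrable_on {0..s}" by (intro integrable_diff ig s)
      show "(\<lambda>t. L * exp (2 * L * t) * D) integrable_on {0..s}" using E by blast
      fix t assume "t \<in> {0..s}"
      then have "\<bar>g \<psi> t - g \<phi> t\<bar> \<le> L * \<bar>exp (2 * L * t) * \<psi> t - exp (2 * L * t) * \<phi> t\<bar>"
        unfolding g_def using s by (intro lip) auto
      also have "\<dots> = L * exp (2 * L * t) * \<bar>\<psi> t - \<phi> t\<bar>"
        by (simp add: abs_mult right_diff_distrib [symmetric])
      also have "\<dots> \<le> L * exp (2 * L * t) * D"
        using dist_bounded [of \<psi> t \<phi>] L unfolding D_def dist_real_def by (intro mult_left_mono) auto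
      finally show "norm (g \<psi> t - g \<phi> t) \<le> L * exp (2 * L * t) * D" by simp
    qed
    also have "\<dots> = (exp (2 * L * s) - 1) * D / 2" using integral_unique [OF E] by (simp add: algebra_simps diff_divide_distrib)
    finally have "exp (- (2 * L * s)) * \<bar>integral {0..s} (\<lambda>t. g \<psi> t - g \<phi> t)\<bar> \<le>
        exp (- (2 * L * s)) * ((exp (2 * L * s) - 1) * D / 2)" by (intro mult_left_mono) auto
    also have "\<dots> = (1 - exp (- (2 * L * s))) * (D / 2)"
    proof -
      have "u * ((v - 1) * D / 2) = (v * u - u) * (D / 2)" for u v :: real by (simp add: field_simps)
      then show ?thesis by (simp only: exp_minus_inverse)
    qed
    also have "\<dots> \<le> 1 * (D / 2)" by (intro mult_right_mono) (auto simp: D_def)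
    finally have "exp (- (2 * L * s)) * \<bar>integral {0..s} (\<lambda>t. g \<psi> t - g \<phi> t)\<bar> \<le> D / 2" by simp
    moreover have "G \<psi> s - G \<phi> s = exp (- (2 * L * s)) * integral {0..s} (\<lambda>t. g \<psi> t - g \<phi> t)"
      by (simp add: G_def integral_diff [OF ig [OF s] ig [OF s]] algebra_simps)
    ultimately show "dist (T \<psi> x) (T \<phi> x) \<le> 1 / 2 * dist \<psi> \<phi>"
      by (simp add: T dist_real_def s_def [symmetric] D_def abs_mult)
  qed
  then have "\<exists>!\<psi>. T \<psi> = \<psi>" by (intro banach_fix_type [of "1 / 2"]) auto
  then obtain \<psi> where \<psi>: "T \<psi> = \<psi>" by blast
  define \<theta> where "\<theta> = (\<lambda>x. c + integral {0..x} (g \<psi>))"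
  have \<theta>: "exp (2 * L * x) * \<psi> x = \<theta> x" if "x \<in> {0..1}" for x
  proof -
    have "\<psi> x = exp (- (2 * L * x)) * \<theta> x"
      using T [of \<psi> x] kid [OF that] by (simp add: \<psi> G_def \<theta>_def)
    then show ?thesis by (simp add: exp_minus)
  qed
  have "(\<theta> has_real_derivative F x (\<theta> x)) (at x within {0..1})" if "x \<in> {0..1}" for x
  proof -
    have "(\<theta> has_real_derivative 0 + g \<psi> x) (at x within {0..1})"
      unfolding \<theta>_def by (intro DERIV_add DERIV_const integral_has_real_derivative cg that)
    moreover have "g \<psi> x = F x (\<theta> x)" using \<theta> [OF that] by (simp add: g_def)
    ultimately show ?thesis by simp
  qed
  moreover have "\<theta> 0 = c" by (simp add: \<theta>_def)
  ultimately show ?thesis by blast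
qed

text \<open>
  Gronwall estimate for the squared difference \<open>d\<^sup>2\<close> of two solutions: \<open>(d\<^sup>2)' \<le> (2 L + 1) d\<^sup>2 + \<epsilon>\<^sup>2\<close>, so
  \<open>d\<^sup>2 exp (- (2 L + 1) x) - \<epsilon>\<^sup>2 x\<close> is nonincreasing.
\<close>

lemma gronwall_unit_interval:
  fixes F1 F2 :: "real \<Rightarrow> real \<Rightarrow> real"
  assumes \<theta>1: "\<And>x. x \<in> {0..1} \<Longrightarrow> (\<theta>1 has_real_derivative F1 x (\<theta>1 x)) (at x within {0..1})"
    and \<theta>2: "\<And>x. x \<in> {0..1} \<Longrightarrow> (\<theta>2 has_real_derivative F2 x (\<theta>2 x)) (at x within {0..1})"
    and 0: "\<theta>1 0 = \<theta>2 0" and L: "L \<ge> 0" and eps: "\<epsilon> \<ge> 0"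
    and lip: "\<And>t z z'. t \<in> {0..1} \<Longrightarrow> \<bar>F1 t z - F1 t z'\<bar> \<le> L * \<bar>z - z'\<bar>"
    and near: "\<And>t z. t \<in> {0..1} \<Longrightarrow> \<bar>F1 t z - F2 t z\<bar> \<le> \<epsilon>"
  shows "\<bar>\<theta>1 1 - \<theta>2 1\<bar> \<le> \<epsilon> * exp (L + 1)"
proof -
  define d where "d = (\<lambda>x. \<theta>1 x - \<theta>2 x)"
  define d' where "d' = (\<lambda>x. F1 x (\<theta>1 x) - F2 x (\<theta>2 x))"
  define h where "h = (\<lambda>x. (d x)\<^sup>2 * exp (- ((2 * L + 1) * x)) - \<epsilon>\<^sup>2 * x)"
  have d: "(d has_real_derivative d' x) (at x within {0..1})" if "x \<in> {0..1}" for x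
    unfolding d_def d'_def by (intro DERIV_diff \<theta>1 \<theta>2 that)
  have h: "(h has_real_derivative exp (- ((2 * L + 1) * x)) * (2 * d x * d' x - (2 * L + 1) * (d x)\<^sup>2) - \<epsilon>\<^sup>2)
      (at x within {0..1})" if "x \<in> {0..1}" for x
    unfolding h_def by (rule derivative_eq_intros d [OF that] refl)+ (simp add: algebra_simps)
  have neg: "exp (- ((2 * L + 1) * x)) * (2 * d x * d' x - (2 * L + 1) * (d x)\<^sup>2) - \<epsilon>\<^sup>2 \<le> 0"
    if x: "x \<in> {0..1}" for x
  proof -
    have "\<bar>d' x\<bar> \<le> L * \<bar>d x\<bar> + \<epsilon>"
      using lip [OF x, of "\<theta>1 x" "\<theta>2 x"] near [OF x, of "\<theta>2 x"] unfolding d_def d'_def by linarith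
    then have "\<bar>d x\<bar> * \<bar>d' x\<bar> \<le> \<bar>d x\<bar> * (L * \<bar>d x\<bar> + \<epsilon>)" by (intro mult_left_mono) auto
    then have "2 * d x * d' x \<le> 2 * L * (d x)\<^sup>2 + 2 * (\<bar>d x\<bar> * \<epsilon>)"
      using abs_ge_self [of "d x * d' x"] by (simp add: abs_mult power2_eq_square algebra_simps abs_mult_self_eq)
    also have "2 * (\<bar>d x\<bar> * \<epsilon>) \<le> (d x)\<^sup>2 + \<epsilon>\<^sup>2"
      using sum_squares_bound [of "\<bar>d x\<bar>" \<epsilon>] by simp
    finally have *: "2 * d x * d' x - (2 * L + 1) * (d x)\<^sup>2 \<le> \<epsilon>\<^sup>2" by (simp add: algebra_simps)
    have "exp (- ((2 * L + 1) * x)) * (2 * d x * d' x - (2 * L + 1) * (d x)\<^sup>2) \<le> exp (- ((2 * L + 1) * x)) * \<epsilon>\<^sup>2"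
      using * by (intro mult_left_mono) auto
    also have "\<dots> \<le> 1 * \<epsilon>\<^sup>2" using x L by (intro mult_right_mono) auto
    finally show ?thesis by simp
  qed
  have "h 1 \<le> h 0"
  proof (rule DERIV_nonpos_imp_decreasing_open [of 0 1 h])
    show "continuous_on {0..1} h"
      using h by (rule DERIV_continuous_on)
    show "\<exists>y. (h has_real_derivative y) (at x) \<and> y \<le> 0" if "0 < x" "x < 1" for x
      using h [of x] neg [of x] that at_within_interior [of x "{0..1}"] by auto
  qed auto
  then have "(d 1)\<^sup>2 * exp (- (2 * L + 1)) \<le> \<epsilon>\<^sup>2" using 0 by (simp add: h_def d_def)
  then have "(d 1)\<^sup>2 * exp (- (2 * L + 1)) * exp (2 * L + 1) \<le> \<epsilon>\<^sup>2 * exp (2 * L + 1)"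
    by (rule mult_right_mono) simp
  then have "(d 1)\<^sup>2 \<le> \<epsilon>\<^sup>2 * exp (2 * L + 1)"
    by (simp add: mult.assoc exp_add [symmetric])
  also have "\<dots> \<le> \<epsilon>\<^sup>2 * exp (2 * (L + 1))" by (intro mult_left_mono) auto
  also have "\<dots> = (\<epsilon> * exp (L + 1))\<^sup>2"
    by (simp only: power_mult_distrib exp_double)
  finally have "\<bar>d 1\<bar> \<le> \<epsilon> * exp (L + 1)"
    by (metis abs_le_square_iff abs_of_nonneg eps exp_ge_zero mult_nonneg_nonneg)
  then show ?thesis by (simp add: d_def)
qed

text \<open>
  A function that starts at or below \<open>0\<close> and can meet the level \<open>0\<close> only while strictly decreasing cannot return to it: at the
  first return the derivative would be nonnegative.
\<close>

lemma stays_negative: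
  fixes d d' :: "real \<Rightarrow> real"
  assumes d: "\<And>x. x \<in> {a..b} \<Longrightarrow> (d has_real_derivative d' x) (at x within {a..b})"
    and a: "d a \<le> 0" and neg: "\<And>x. x \<in> {a..b} \<Longrightarrow> d x = 0 \<Longrightarrow> d' x < 0"
    and x: "x \<in> {a<..b}"
  shows "d x < 0"
proof (rule ccontr)
  assume nx: "\<not> d x < 0"
  have cont: "continuous_on {a..b} d"
    using d by (rule DERIV_continuous_on)
  have "\<exists>t0\<in>{a..<x}. d t0 < 0"
  proof (cases "d a = 0")
    case True
    have ab: "a \<in> {a..b}" using x by auto
    obtain e where e: "e > 0" "\<And>h. h > 0 \<Longrightarrow> a + h \<in> {a..b} \<Longrightarrow> h < e \<Longrightarrow> d (a + h) < d a"
      using has_real_derivative_neg_dec_right [OF d [OF ab] neg [OF ab True]] by auto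
    define h where "h = min (e / 2) ((x - a) / 2)"
    have h: "h > 0" "h < e" "a + h < x" using e x by (auto simp: h_def min_def field_simps)
    then show ?thesis using e(2) [of h] x True by (intro bexI [of _ "a + h"]) auto
  qed (use a x in force)
  then obtain t0 where t0: "t0 \<in> {a..<x}" "d t0 < 0" by blast
  define Z where "Z = {t \<in> {t0..x}. d t = 0}"
  have c: "continuous_on {t0..x} d" by (rule continuous_on_subset [OF cont]) (use t0 x in auto)
  have "closed Z" unfolding Z_def
    using continuous_closed_preimage_constant [OF c, of 0] by simp
  moreover have "Z \<noteq> {}"
    using IVT' [of d t0 0 x] t0 nx c by (auto simp: Z_def)
  moreover have "bdd_below Z" by (auto simp: Z_def bdd_below_def)
  ultimately have s: "Inf Z \<in> Z" by (rule closed_contains_Inf [rotated 2])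
  define s where "s = Inf Z"
  have s: "s \<in> {t0..x}" "d s = 0" using s by (auto simp: s_def Z_def)
  have "t0 < s" using s t0 by (cases "s = t0") auto
  have below: "d t < 0" if t: "t \<in> {t0..<s}" for t
  proof (rule ccontr)
    assume "\<not> d t < 0"
    moreover have "continuous_on {t0..t} d" by (rule continuous_on_subset [OF c]) (use t s in auto)
    ultimately obtain r where "t0 \<le> r" "r \<le> t" "d r = 0"
      using IVT' [of d t0 0 t] t0 t by auto
    then have "r \<in> Z" using t s by (auto simp: Z_def)
    then have "s \<le> r" unfolding s_def using \<open>bdd_below Z\<close> by (intro cInf_lower)
    then show False using \<open>r \<le> t\<close> t by auto
  qed
  have sab: "s \<in> {a..b}" using s t0 x by auto
  obtain e where e: "e > 0" "\<And>h. h > 0 \<Longrightarrow> s - h \<in> {a..b} \<Longrightarrow> h < e \<Longrightarrow> d s < d (s - h)"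
    using has_real_derivative_neg_dec_left [OF d [OF sab] neg [OF sab s(2)]] by auto
  define h where "h = min (e / 2) (s - t0)"
  have h: "h > 0" "h < e" "s - h \<in> {t0..<s}" using e \<open>t0 < s\<close> by (auto simp: h_def min_def field_simps)
  then show False using e(2) [of h] below [of "s - h"] s t0 x by auto
qed

section \<open>The angular equation\<close>

definition angle_weight :: "real \<Rightarrow> real \<Rightarrow> real" where
  "angle_weight p z = (p - 1) * (cos z)\<^sup>2 + (sin z)\<^sup>2"

text \<open>
  Angle coordinates for the pair of \<open>y\<close> and its flux: \<open>y = r sin \<theta>\<close> and \<open>y'\<^sup>(\<^sup>p\<^sup>-\<^sup>1\<^sup>) = r\<^sup>p\<^sup>-\<^sup>1 cos \<theta>\<close>, with the ordinary
  sine and cosine but with the powers of \<open>r\<close> adapted to the homogeneity of the equation. For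
  \<open>(y'\<^sup>(\<^sup>p\<^sup>-\<^sup>1\<^sup>))' = - (p - 1) c y\<^sup>(\<^sup>p\<^sup>-\<^sup>1\<^sup>)\<close>, eliminating \<open>r\<close> leaves \<open>\<theta>' = angle_speed p c \<theta>\<close>. In contrast to the
  system for \<open>y\<close> and its flux, this right-hand side is Lipschitz in the unknown for every \<open>p > 1\<close>.
\<close>

definition angle_speed :: "real \<Rightarrow> real \<Rightarrow> real \<Rightarrow> real" where
  "angle_speed p c z = (p - 1) * (\<bar>cos z\<bar> powr (p / (p - 1)) + c * \<bar>sin z\<bar> powr p) / angle_weight p z"

lemma angle_weight_ge:
  shows "min (p - 1) 1 \<le> angle_weight p z"
proof -
  have "min (p - 1) 1 * ((cos z)\<^sup>2 + (sin z)\<^sup>2) \<le> angle_weight p z"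
    using mult_right_mono [of "min (p - 1) 1" "p - 1" "(cos z)\<^sup>2"] mult_right_mono [of "min (p - 1) 1" 1 "(sin z)\<^sup>2"]
    by (simp only: angle_weight_def distrib_left) simp
  then show ?thesis by simp
qed

lemma angle_weight_pos: "p > 1 \<Longrightarrow> angle_weight p z > 0"
  using angle_weight_ge [of p z] by linarith

lemma angle_weight_le:
  assumes "p > 1" shows "angle_weight p z \<le> p"
proof -
  have "(p - 1) * (cos z)\<^sup>2 \<le> (p - 1) * 1" "(sin z)\<^sup>2 \<le> 1"
    using assms by (auto intro!: mult_left_mono simp: abs_square_le_1)
  then show ?thesis by (simp add: angle_weight_def)
qed

lemma quotient_angle_weight_lipschitz:
  assumes p: "p > 1" and N: "\<And>z. (N has_real_derivative N' z) (at z)"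
    and b: "\<And>z. \<bar>N z\<bar> \<le> 1" "\<And>z. \<bar>N' z\<bar> \<le> k"
  shows "\<exists>K\<ge>0. \<forall>z z'. \<bar>N z / angle_weight p z - N z' / angle_weight p z'\<bar> \<le> K * \<bar>z - z'\<bar>"
proof -
  define W' where "W' = (\<lambda>z. 2 * (2 - p) * sin z * cos z)"
  define m where "m = min (p - 1) 1"
  have m: "m > 0" using p by (simp add: m_def)
  have W: "(angle_weight p has_real_derivative W' z) (at z)" for z
    unfolding angle_weight_def W'_def by (auto intro!: derivative_eq_intros simp: algebra_simps power2_eq_square)
  have sc: "\<bar>sin z * cos z\<bar> \<le> 1" for z :: real
    unfolding abs_mult by (intro mult_le_one) auto
  have W'b: "\<bar>W' z\<bar> \<le> 2 * \<bar>2 - p\<bar>" for z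
  proof -
    have "\<bar>W' z\<bar> = \<bar>2\<bar> * \<bar>2 - p\<bar> * \<bar>sin z * cos z\<bar>"
      unfolding W'_def by (simp only: abs_mult mult.assoc)
    also have "\<dots> \<le> \<bar>2\<bar> * \<bar>2 - p\<bar>" by (rule mult_left_le) (use sc in auto)
    finally show ?thesis by simp
  qed
  have k: "k \<ge> 0" using b(2) [of 0] by linarith
  define K where "K = (k * p + 2 * \<bar>2 - p\<bar>) / m\<^sup>2"
  have "norm (N z / angle_weight p z - N z' / angle_weight p z') \<le> K * norm (z - z')" for z z'
  proof (rule field_differentiable_bound [of UNIV])
    fix z
    show "((\<lambda>z. N z / angle_weight p z) has_real_derivative
       (N' z * angle_weight p z - N z * W' z) / (angle_weight p z * angle_weight p z)) (at z within UNIV)"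
      using angle_weight_pos [OF p, of z] by (intro DERIV_divide N W) auto
    have "\<bar>N' z * angle_weight p z - N z * W' z\<bar> \<le> \<bar>N' z\<bar> * \<bar>angle_weight p z\<bar> + \<bar>N z\<bar> * \<bar>W' z\<bar>"
      unfolding abs_mult [symmetric] by (rule abs_triangle_ineq4)
    also have "\<dots> \<le> k * p + 1 * (2 * \<bar>2 - p\<bar>)"
      using b W'b k angle_weight_le [OF p, of z] angle_weight_pos [OF p, of z]
      by (intro add_mono mult_mono) auto
    finally have n: "\<bar>N' z * angle_weight p z - N z * W' z\<bar> \<le> k * p + 2 * \<bar>2 - p\<bar>" by simp
    have "m\<^sup>2 \<le> angle_weight p z * angle_weight p z"
      using angle_weight_ge [of p z] m unfolding power2_eq_square m_def by (intro mult_mono) auto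
    then show "norm ((N' z * angle_weight p z - N z * W' z) / (angle_weight p z * angle_weight p z)) \<le> K"
      unfolding K_def real_norm_def abs_divide using n m k p by (intro frac_le) auto
  qed auto
  moreover have "K \<ge> 0" using k p by (simp add: K_def)
  ultimately show ?thesis by auto
qed

text \<open>
  Both exponents \<open>p\<close> and \<open>p / (p - 1)\<close> exceed \<open>1\<close>, so the powers of \<open>\<bar>sin\<bar>\<close> and \<open>\<bar>cos\<bar>\<close> in the numerator are
  continuously differentiable with bounded derivatives.
\<close>

lemma angle_speed_lipschitz:
  assumes p: "p > 1"
  shows "\<exists>K>0. \<forall>c z z'. \<bar>angle_speed p c z - angle_speed p c z'\<bar> \<le> K * (1 + \<bar>c\<bar>) * \<bar>z - z'\<bar>"
proof -
  define p' where "p' = p / (p - 1)"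
  have p': "p' > 1" using p by (simp add: p'_def)
  have le: "\<bar>x\<bar> powr a \<le> 1" if "\<bar>x\<bar> \<le> 1" "a > 0" for x a :: real
    using that by (intro powr_le1) auto
  have A: "((\<lambda>z. \<bar>cos z\<bar> powr p') has_real_derivative p' * spow p' (cos z) * (- sin z)) (at z)" for z
    by (rule DERIV_chain2 [OF DERIV_abs_powr [OF p']]) (auto intro!: derivative_eq_intros)
  have B: "((\<lambda>z. \<bar>sin z\<bar> powr p) has_real_derivative p * spow p (sin z) * cos z) (at z)" for z
    by (rule DERIV_chain2 [OF DERIV_abs_powr [OF p]]) (auto intro!: derivative_eq_intros)
  have "\<bar>spow p' (cos z) * (- sin z)\<bar> \<le> 1" for z
    unfolding abs_mult abs_spow using p' by (intro mult_le_one le) auto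
  then have bA: "\<bar>p' * spow p' (cos z) * (- sin z)\<bar> \<le> p'" for z
    using p' mult_left_le [of "\<bar>spow p' (cos z) * (- sin z)\<bar>" p'] by (simp add: abs_mult mult.assoc)
  have "\<bar>spow p (sin z) * cos z\<bar> \<le> 1" for z
    unfolding abs_mult abs_spow using p by (intro mult_le_one le) auto
  then have bB: "\<bar>p * spow p (sin z) * cos z\<bar> \<le> p" for z
    using p mult_left_le [of "\<bar>spow p (sin z) * cos z\<bar>" p] by (simp add: abs_mult mult.assoc)
  obtain K1 where K1: "K1 \<ge> 0" "\<And>z z'. \<bar>\<bar>cos z\<bar> powr p' / angle_weight p z - \<bar>cos z'\<bar> powr p' / angle_weight p z'\<bar> \<le> K1 * \<bar>z - z'\<bar>"
    using quotient_angle_weight_lipschitz [OF p A _ bA] le p' by fastforce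
  obtain K2 where K2: "K2 \<ge> 0" "\<And>z z'. \<bar>\<bar>sin z\<bar> powr p / angle_weight p z - \<bar>sin z'\<bar> powr p / angle_weight p z'\<bar> \<le> K2 * \<bar>z - z'\<bar>"
    using quotient_angle_weight_lipschitz [OF p B _ bB] le p by fastforce
  define K where "K = (p - 1) * (K1 + K2) + 1"
  have "\<bar>angle_speed p c z - angle_speed p c z'\<bar> \<le> K * (1 + \<bar>c\<bar>) * \<bar>z - z'\<bar>" for c z z'
  proof -
    define a where "a = \<bar>cos z\<bar> powr p' / angle_weight p z - \<bar>cos z'\<bar> powr p' / angle_weight p z'"
    define b where "b = \<bar>sin z\<bar> powr p / angle_weight p z - \<bar>sin z'\<bar> powr p / angle_weight p z'"
    have eq: "angle_speed p c z - angle_speed p c z' = (p - 1) * (a + c * b)"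
      by (simp add: angle_speed_def p'_def a_def b_def algebra_simps add_divide_distrib diff_divide_distrib)
    have "\<bar>a + c * b\<bar> \<le> K1 * \<bar>z - z'\<bar> + \<bar>c\<bar> * (K2 * \<bar>z - z'\<bar>)"
      by (rule order_trans [OF abs_triangle_ineq])
         (use K1(2) [of z z'] K2(2) [of z z'] in \<open>auto simp: abs_mult a_def b_def intro!: add_mono mult_left_mono\<close>)
    also have "\<dots> \<le> (K1 + K2) * (1 + \<bar>c\<bar>) * \<bar>z - z'\<bar>"
      using K1(1) K2(1) by (simp add: algebra_simps)
    finally have "(p - 1) * \<bar>a + c * b\<bar> \<le> (p - 1) * ((K1 + K2) * (1 + \<bar>c\<bar>) * \<bar>z - z'\<bar>)"
      by (rule mult_left_mono) (use p in simp)
    moreover have "\<bar>angle_speed p c z - angle_speed p c z'\<bar> = (p - 1) * \<bar>a + c * b\<bar>"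
      unfolding eq using p by (simp add: abs_mult)
    ultimately have "\<bar>angle_speed p c z - angle_speed p c z'\<bar> \<le> (p - 1) * ((K1 + K2) * (1 + \<bar>c\<bar>) * \<bar>z - z'\<bar>)"
      by simp
    also have "\<dots> \<le> K * (1 + \<bar>c\<bar>) * \<bar>z - z'\<bar>"
      unfolding K_def by (simp add: algebra_simps)
    finally show ?thesis .
  qed
  moreover have "K > 0" using K1 K2 p by (simp add: K_def add_nonneg_pos)
  ultimately show ?thesis by blast
qed

lemma angle_speed_diff_le:
  assumes p: "p > 1"
  shows "\<bar>angle_speed p c z - angle_speed p c' z\<bar> \<le> (p - 1) / min (p - 1) 1 * \<bar>c - c'\<bar>"
proof -
  have "angle_speed p c z - angle_speed p c' z = (p - 1) / angle_weight p z * ((c - c') * \<bar>sin z\<bar> powr p)"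
    by (simp add: angle_speed_def algebra_simps add_divide_distrib diff_divide_distrib)
  moreover have "\<bar>sin z\<bar> powr p \<le> 1" using p by (intro powr_le1) auto
  moreover have "\<bar>(p - 1) / angle_weight p z\<bar> \<le> (p - 1) / min (p - 1) 1"
    using angle_weight_pos [OF p, of z] angle_weight_ge [of p z] p by (simp add: frac_le)
  ultimately show ?thesis
    using p by (simp only: abs_mult) (intro mult_mono, auto simp: mult_left_le)
qed

section \<open>Angle coordinates and shooting\<close>

lemma continuous_on_abs_powr:
  fixes g :: "'a::topological_space \<Rightarrow> real"
  assumes "a > 0" "continuous_on S g"
  shows "continuous_on S (\<lambda>x. \<bar>g x\<bar> powr a)"
  using assms by (intro continuous_on_powr' continuous_intros) auto

lemma prufer_angle_exists:
  assumes p: "p > 1" and c: "continuous_on {0..1} c"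
  shows "\<exists>\<theta>. \<theta> 0 = a \<and> (\<forall>x\<in>{0..1}. (\<theta> has_real_derivative angle_speed p (c x) (\<theta> x)) (at x within {0..1}))"
proof -
  obtain K where K: "K > 0" "\<And>c z z'. \<bar>angle_speed p c z - angle_speed p c z'\<bar> \<le> K * (1 + \<bar>c\<bar>) * \<bar>z - z'\<bar>"
    using angle_speed_lipschitz [OF p] by blast
  have "bounded (c ` {0..1})" by (intro compact_imp_bounded compact_continuous_image c) auto
  then obtain M where M: "\<And>x. x \<in> {0..1} \<Longrightarrow> \<bar>c x\<bar> \<le> M" unfolding bounded_iff by fastforce
  have M0: "M \<ge> 0" using M [of 0] by simp
  show ?thesis
  proof (rule picard_unit_interval)
    show "K * (1 + M) > 0" using K M0 by simp
    fix t z z' :: real assume t: "t \<in> {0..1}"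
    have "K * (1 + \<bar>c t\<bar>) * \<bar>z - z'\<bar> \<le> K * (1 + M) * \<bar>z - z'\<bar>"
      using M [OF t] K(1) by (intro mult_right_mono mult_left_mono) auto
    then show "\<bar>angle_speed p (c t) z - angle_speed p (c t) z'\<bar> \<le> K * (1 + M) * \<bar>z - z'\<bar>"
      using K(2) [of "c t" z z'] by linarith
  next
    have "continuous_on ({0..1} \<times> UNIV) (\<lambda>x. c (fst x))"
      by (rule continuous_on_compose2 [OF c]) (auto intro!: continuous_intros)
    then have "continuous_on ({0..1} \<times> UNIV) (\<lambda>x. angle_speed p (c (fst x)) (snd x :: real))"
      unfolding angle_speed_def
      using p angle_weight_pos [OF p] unfolding angle_weight_def
      by (intro continuous_intros continuous_on_abs_powr) (auto simp: less_imp_neq [symmetric])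
    then show "continuous_on ({0..1} \<times> UNIV) (\<lambda>(t, z). angle_speed p (c t) z)"
      by (simp add: case_prod_unfold)
  qed
qed

text \<open>
  The angle determines the amplitude through \<open>r'/r = \<rho>\<close>; the formula for \<open>\<rho>\<close> comes from eliminating \<open>\<theta>'\<close>
  from the two equations
  \<open>r' sin \<theta> + r \<theta>' cos \<theta> = y'\<close> and \<open>(p - 1) r' cos \<theta> - r \<theta>' sin \<theta> = - (p - 1) c r sin\<^sup>(\<^sup>p\<^sup>-\<^sup>1\<^sup>) \<theta>\<close>.
  The proof reads these equations backwards.
\<close>

lemma prufer_solution:
  assumes p: "p > 1" and c: "continuous_on {0..1} c"
    and \<theta>: "\<And>x. x \<in> {0..1} \<Longrightarrow> (\<theta> has_real_derivative angle_speed p (c x) (\<theta> x)) (at x within {0..1})"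
  shows "\<exists>r y. (\<forall>x. r x > 0 \<and> y x = r x * sin (\<theta> x)) \<and>
    (\<forall>x\<in>{0..1}. D01 y x = r x * spow (p / (p - 1)) (cos (\<theta> x))) \<and> regular p y \<and>
    (\<forall>x\<in>{0<..<1}. deriv (flux p y) x = - (p - 1) * c x * spow p (y x))"
proof -
  define p' where "p' = p / (p - 1)"
  have p': "p' > 1" using p by (simp add: p'_def)
  have c\<theta>: "continuous_on {0..1} \<theta>" using \<theta> by (rule DERIV_continuous_on)
  define W where "W = (\<lambda>x. angle_weight p (\<theta> x))"
  have W: "W x > 0" for x using angle_weight_pos [OF p] by (simp add: W_def)
  define \<rho> where "\<rho> = (\<lambda>x. (spow p' (cos (\<theta> x)) * sin (\<theta> x) - (p - 1) * c x * spow p (sin (\<theta> x)) * cos (\<theta> x)) / W x)"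
  define R where "R = (\<lambda>x. integral {0..x} \<rho>)"
  define r where "r = (\<lambda>x. exp (R x))"
  define y where "y = (\<lambda>x. r x * sin (\<theta> x))"
  define v where "v = (\<lambda>x. exp ((p - 1) * R x) * cos (\<theta> x))"
  have "continuous_on {0..1} W" unfolding W_def angle_weight_def by (intro continuous_intros c\<theta>)
  then have "continuous_on {0..1} \<rho>"
    unfolding \<rho>_def using W by (intro continuous_intros c\<theta> c p p') (auto simp: less_imp_neq [symmetric])
  then have R: "(R has_real_derivative \<rho> x) (at x within {0..1})" if "x \<in> {0..1}" for x
    unfolding R_def using that by (rule integral_has_real_derivative)
  have cR: "continuous_on {0..1} R" using R by (rule DERIV_continuous_on)
  define \<theta>' where "\<theta>' = (\<lambda>x. angle_speed p (c x) (\<theta> x))"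
  have \<theta>'W: "\<theta>' x * W x = (p - 1) * (\<bar>cos (\<theta> x)\<bar> powr p' + c x * \<bar>sin (\<theta> x)\<bar> powr p)" for x
    using W [of x] by (simp add: \<theta>'_def angle_speed_def W_def p'_def)
  have \<rho>W: "\<rho> x * W x = spow p' (cos (\<theta> x)) * sin (\<theta> x) - (p - 1) * c x * spow p (sin (\<theta> x)) * cos (\<theta> x)" for x
    using W [of x] by (simp add: \<rho>_def)
  have Weq: "W x = (p - 1) * (cos (\<theta> x))\<^sup>2 + (sin (\<theta> x))\<^sup>2" for x by (simp add: W_def angle_weight_def)
  have y': "\<rho> x * sin (\<theta> x) + cos (\<theta> x) * \<theta>' x = spow p' (cos (\<theta> x))" for x
  proof -
    have "(\<rho> x * sin (\<theta> x) + cos (\<theta> x) * \<theta>' x) * W x = (\<rho> x * W x) * sin (\<theta> x) + cos (\<theta> x) * (\<theta>' x * W x)"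
      by (simp add: algebra_simps)
    also have "\<dots> = spow p' (cos (\<theta> x)) * W x"
      unfolding \<theta>'W \<rho>W unfolding Weq mult_spow [symmetric] by (simp add: algebra_simps power2_eq_square)
    finally show ?thesis using W [of x] by simp
  qed
  have v': "(p - 1) * \<rho> x * cos (\<theta> x) - sin (\<theta> x) * \<theta>' x = - (p - 1) * c x * spow p (sin (\<theta> x))" for x
  proof -
    have "((p - 1) * \<rho> x * cos (\<theta> x) - sin (\<theta> x) * \<theta>' x) * W x =
       (p - 1) * (\<rho> x * W x) * cos (\<theta> x) - sin (\<theta> x) * (\<theta>' x * W x)"
      by (simp add: algebra_simps)
    also have "\<dots> = (- (p - 1) * c x * spow p (sin (\<theta> x))) * W x"
      unfolding \<theta>'W \<rho>W unfolding Weq mult_spow [symmetric] by (simp add: algebra_simps power2_eq_square)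
    finally show ?thesis using W [of x] by simp
  qed
  have dy: "(y has_real_derivative r x * spow p' (cos (\<theta> x))) (at x within {0..1})" if x: "x \<in> {0..1}" for x
  proof -
    have "(y has_real_derivative r x * (\<rho> x * sin (\<theta> x) + cos (\<theta> x) * \<theta>' x)) (at x within {0..1})"
      unfolding y_def r_def \<theta>'_def by (rule derivative_eq_intros R \<theta> x refl)+ (simp add: algebra_simps)
    then show ?thesis by (simp only: y')
  qed
  have D: "D01 y x = r x * spow p' (cos (\<theta> x))" if "x \<in> {0..1}" for x
    by (rule D01_eqI [OF dy [OF that] that])
  have C1: "C1_01 y"
    unfolding C1_01_def
  proof
    show "y differentiable_on {0..1}"
      using dy unfolding differentiable_on_def real_differentiable_def by blast
    have "continuous_on {0..1} (\<lambda>x. r x * spow p' (cos (\<theta> x)))"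
      unfolding r_def by (intro continuous_intros cR c\<theta> p')
    then show "continuous_on {0..1} (D01 y)"
      by (rule continuous_on_eq) (simp add: D)
  qed
  have "spow p (r x) = exp ((p - 1) * R x)" for x
    by (simp add: r_def spow_pos powr_def)
  then have fl: "flux p y x = v x" if "x \<in> {0..1}" for x
    using spow_inverse [OF p] by (simp add: D [OF that] spow_mult v_def p'_def)
  have dv: "(flux p y has_real_derivative - (p - 1) * c x * spow p (y x)) (at x)" if x: "x \<in> {0<..<1}" for x
  proof -
    have x1: "x \<in> {0..1}" using x by auto
    have "(v has_real_derivative exp ((p - 1) * R x) * ((p - 1) * \<rho> x * cos (\<theta> x) - sin (\<theta> x) * \<theta>' x)) (at x within {0..1})"
      unfolding v_def \<theta>'_def by (rule derivative_eq_intros R \<theta> x1 refl)+ (simp add: algebra_simps)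
    moreover have "exp ((p - 1) * R x) * ((p - 1) * \<rho> x * cos (\<theta> x) - sin (\<theta> x) * \<theta>' x) = - (p - 1) * c x * spow p (y x)"
      unfolding v' by (simp add: y_def spow_mult r_def spow_pos powr_def)
    ultimately have "(v has_real_derivative - (p - 1) * c x * spow p (y x)) (at x)"
      using x at_within_interior [of x "{0..1}"] by simp
    then show ?thesis
      by (rule has_field_derivative_transform_within_open [of _ _ _ "{0<..<1}"]) (use x fl in auto)
  qed
  have "regular p y"
    unfolding regular_def using C1 dv real_differentiable_def by blast
  moreover have "deriv (flux p y) x = - (p - 1) * c x * spow p (y x)" if "x \<in> {0<..<1}" for x
    by (rule DERIV_imp_deriv [OF dv [OF that]])
  ultimately show ?thesis
    using D unfolding p'_def by (intro exI [of _ r] exI [of _ y]) (auto simp: y_def r_def)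
qed

text \<open>
  At a multiple of \<open>\<pi>\<close> the angular speed is \<open>1\<close> for every coefficient, so the angle crosses such levels
  only upwards.
\<close>

lemma angle_crosses_upwards:
  assumes p: "p > 1"
    and \<theta>: "\<And>x. x \<in> {0..1} \<Longrightarrow> (\<theta> has_real_derivative angle_speed p (c x) (\<theta> x)) (at x within {0..1})"
    and a: "a \<in> {0..1}" "of_int m * pi \<le> \<theta> a" and x: "x \<in> {a<..1}"
  shows "of_int m * pi < \<theta> x"
proof -
  have "of_int m * pi - \<theta> x < 0"
  proof (rule stays_negative [of a 1 "\<lambda>x. of_int m * pi - \<theta> x" "\<lambda>x. 0 - angle_speed p (c x) (\<theta> x)"])
    fix t assume t: "t \<in> {a..1}"
    then have "(\<theta> has_real_derivative angle_speed p (c t) (\<theta> t)) (at t within {a..1})"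
      using a by (intro DERIV_subset [OF \<theta>]) auto
    then show "((\<lambda>x. of_int m * pi - \<theta> x) has_real_derivative 0 - angle_speed p (c t) (\<theta> t)) (at t within {a..1})"
      by (intro DERIV_diff DERIV_const)
    assume "of_int m * pi - \<theta> t = 0"
    then have "sin (\<theta> t) = 0"
      unfolding sin_zero_iff_int2 by (intro exI [of _ m]) simp
    moreover from this have "\<bar>cos (\<theta> t)\<bar> = 1" by (rule sin_zero_abs_cos_one)
    moreover from this have "(cos (\<theta> t))\<^sup>2 = 1" by (simp add: abs_square_eq_1)
    ultimately show "0 - angle_speed p (c t) (\<theta> t) < 0"
      using p by (simp add: angle_speed_def angle_weight_def)
  qed (use a x in auto)
  then show ?thesis by simp
qed

text \<open>
  Zeros correspond to passages of the angle through multiples of \<open>\<pi>\<close>, and each multiple is passed at most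
  once.
\<close>

lemma card_zeros_less_angle:
  assumes p: "p > 1"
    and \<theta>: "\<And>x. x \<in> {0..1} \<Longrightarrow> (\<theta> has_real_derivative angle_speed p (c x) (\<theta> x)) (at x within {0..1})"
    and 0: "\<theta> 0 \<ge> 0"
  shows "finite {x \<in> {0<..<1}. sin (\<theta> x) = 0} \<and> card {x \<in> {0<..<1}. sin (\<theta> x) = 0} * pi < \<theta> 1"
proof -
  define Z where "Z = {x \<in> {0<..<1}. sin (\<theta> x) = 0}"
  have "\<exists>m::int. \<theta> x = of_int m * pi" if "x \<in> Z" for x
    using that sin_zero_iff_int2 by (auto simp: Z_def)
  then obtain m :: "real \<Rightarrow> int" where m: "\<And>x. x \<in> Z \<Longrightarrow> \<theta> x = of_int (m x) * pi" by metis
  have cross: "of_int k * pi < \<theta> x" if "a \<in> {0..1}" "of_int k * pi \<le> \<theta> a" "x \<in> {a<..1}" for k a x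
    using angle_crosses_upwards [OF p \<theta> that] .
  have lt: "m x < m x'" if "x \<in> Z" "x' \<in> Z" "x < x'" for x x'
    using cross [of x "m x" x'] m [OF that(1)] m [OF that(2)] that by (auto simp: Z_def)
  have "inj_on m Z"
    by (rule inj_onI) (metis lt linorder_neqE_linordered_idom order_less_irrefl)
  define N where "N = \<lceil>\<theta> 1 / pi\<rceil> - 1"
  have pos: "\<theta> 1 > 0" using cross [of 0 0 1] 0 by simp
  then have N: "N \<ge> 0" "of_int N < \<theta> 1 / pi" unfolding N_def by (auto, linarith)
  have "m ` Z \<subseteq> {1..N}"
  proof
    fix k assume "k \<in> m ` Z"
    then obtain x where x: "x \<in> Z" "k = m x" by blast
    have "0 < \<theta> x" using cross [of 0 0 x] 0 x(1) by (simp add: Z_def)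
    then have "0 < k" using m [OF x(1)] x(2) by (simp add: zero_less_mult_iff)
    moreover have "of_int k * pi < \<theta> 1" using cross [of x k 1] m [OF x(1)] x by (simp add: Z_def)
    then have "of_int k < \<theta> 1 / pi" by (simp add: field_simps)
    then have "k \<le> N" unfolding N_def by linarith
    ultimately show "k \<in> {1..N}" by simp
  qed
  then have "finite (m ` Z)" "card (m ` Z) \<le> card {1..N}"
    by (rule finite_subset, simp) (rule card_mono, simp, fact)
  then have fin: "finite Z" and "card Z \<le> nat N"
    using \<open>inj_on m Z\<close> by (auto simp: card_image finite_image_iff)
  then have "real (card Z) \<le> of_int N" using N by linarith
  then have "real (card Z) < \<theta> 1 / pi" using N by linarith
  then show ?thesis using fin by (simp add: Z_def field_simps)
qed

text \<open>
  For a very negative coefficient the angle runs backwards faster than \<open>\<pi>\<close> whenever it lies in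
  \<open>[\<epsilon>, \<pi> - \<epsilon>]\<close>. It therefore stays below the line \<open>l\<close> that falls from \<open>\<pi> - \<epsilon>\<close> at \<open>0\<close> to \<open>\<epsilon>\<close> at \<open>1\<close> with slope
  \<open>- (\<pi> - 2 \<epsilon>)\<close>.
\<close>

lemma angle_stays_below:
  assumes p: "p > 1" and \<epsilon>: "0 < \<epsilon>" "\<epsilon> < pi / 2"
    and \<theta>: "\<And>x. x \<in> {0..1} \<Longrightarrow> (\<theta> has_real_derivative angle_speed p (c x) (\<theta> x)) (at x within {0..1})"
    and 0: "\<theta> 0 \<le> pi - \<epsilon>"
    and c: "\<And>x. x \<in> {0..1} \<Longrightarrow> c x \<le> - (1 + pi * p / (p - 1)) / sin \<epsilon> powr p"
  shows "\<theta> 1 < \<epsilon>"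
proof -
  define l where "l = (\<lambda>x. (pi - \<epsilon>) - (pi - 2 * \<epsilon>) * x)"
  have "\<theta> 1 - l 1 < 0"
  proof (rule stays_negative [of 0 1 "\<lambda>x. \<theta> x - l x" "\<lambda>x. angle_speed p (c x) (\<theta> x) - (- (pi - 2 * \<epsilon>))"])
    fix x :: real assume x: "x \<in> {0..1}"
    have "(l has_real_derivative - (pi - 2 * \<epsilon>)) (at x within {0..1})"
      unfolding l_def by (auto intro!: derivative_eq_intros)
    then show "((\<lambda>x. \<theta> x - l x) has_real_derivative angle_speed p (c x) (\<theta> x) - (- (pi - 2 * \<epsilon>))) (at x within {0..1})"
      by (intro DERIV_diff \<theta> x)
    assume "\<theta> x - l x = 0"
    then have z: "\<theta> x = l x" by simp
    have "(pi - 2 * \<epsilon>) * x \<ge> 0" "(pi - 2 * \<epsilon>) * x \<le> (pi - 2 * \<epsilon>) * 1"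
      using x \<epsilon> by (auto intro!: mult_nonneg_nonneg mult_left_mono)
    then have range: "\<epsilon> \<le> \<theta> x" "\<theta> x \<le> pi - \<epsilon>" by (auto simp: z l_def)
    have sin: "sin \<epsilon> \<le> sin (\<theta> x)"
    proof (cases "\<theta> x \<le> pi / 2")
      case True
      then show ?thesis using range \<epsilon> by (intro sin_monotone_2pi_le) auto
    next
      case False
      have "sin \<epsilon> \<le> sin (pi - \<theta> x)" using range \<epsilon> False by (intro sin_monotone_2pi_le) auto
      then show ?thesis by simp
    qed
    have s0: "sin \<epsilon> > 0" using \<epsilon> by (intro sin_gt_zero) auto
    define N where "N = pi * p / (p - 1)"
    have N: "N > 0" using p by (simp add: N_def)
    have c0: "c x \<le> - (1 + N) / sin \<epsilon> powr p" using c [OF x] by (simp add: N_def)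
    then have "c x * sin \<epsilon> powr p \<le> - (1 + N)" using s0 by (simp add: pos_le_divide_eq)
    moreover have "c x \<le> 0" using c0 N s0 by (smt (verit) divide_nonpos_pos powr_gt_zero)
    then have "c x * \<bar>sin (\<theta> x)\<bar> powr p \<le> c x * sin \<epsilon> powr p"
      using sin s0 p by (intro mult_left_mono_neg powr_mono2) auto
    moreover have "\<bar>cos (\<theta> x)\<bar> powr (p / (p - 1)) \<le> 1" using p by (intro powr_le1) auto
    ultimately have num: "\<bar>cos (\<theta> x)\<bar> powr (p / (p - 1)) + c x * \<bar>sin (\<theta> x)\<bar> powr p \<le> - N" by linarith
    have "angle_speed p (c x) (\<theta> x) \<le> (p - 1) * (- N) / angle_weight p (\<theta> x)"
      unfolding angle_speed_def using num p angle_weight_pos [OF p, of "\<theta> x"]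
      by (intro divide_right_mono mult_left_mono) auto
    also have "\<dots> = - (pi * (p / angle_weight p (\<theta> x)))" using p by (simp add: N_def)
    also have "\<dots> \<le> - (pi * 1)"
      using angle_weight_le [OF p, of "\<theta> x"] angle_weight_pos [OF p, of "\<theta> x"] by (simp add: field_simps)
    finally show "angle_speed p (c x) (\<theta> x) - (- (pi - 2 * \<epsilon>)) < 0" using \<epsilon> by simp
  qed (use 0 in \<open>auto simp: l_def\<close>)
  then show ?thesis by (simp add: l_def)
qed

text \<open>
  Every homogeneous boundary condition selects an angle. The left end uses the representative in
  \<open>[0, \<pi>)\<close> and the right end the one in \<open>(0, \<pi>]\<close>; they differ only for the condition \<open>y = 0\<close>.
\<close>

lemma boundary_angle_exists:
  fixes A B :: real
  assumes q: "q > 1" and AB: "A \<noteq> 0 \<or> B \<noteq> 0"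
  shows "\<exists>t\<in>{0..<pi}. A * sin t = B * spow q (cos t)" "\<exists>t\<in>{0<..pi}. A * sin t = B * spow q (cos t)"
proof -
  have "\<exists>t\<in>{0<..<pi}. A * sin t = B * spow q (cos t)" if "B \<noteq> 0"
  proof -
    define h where "h = (\<lambda>t. A * sin t - B * spow q (cos t))"
    have cont: "continuous_on S h" for S unfolding h_def by (intro continuous_intros q)
    have h: "h 0 = - B" "h pi = B" by (simp_all add: h_def spow_def)
    have "\<exists>t. 0 \<le> t \<and> t \<le> pi \<and> h t = 0"
      using IVT' [of h 0 0 pi] IVT2' [of h pi 0 0] h cont that by (cases "B > 0") auto
    then obtain t where t: "0 \<le> t" "t \<le> pi" "h t = 0" by blast
    moreover have "t \<noteq> 0" "t \<noteq> pi" using t(3) h that by auto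
    ultimately show ?thesis by (intro bexI [of _ t]) (auto simp: h_def)
  qed
  then show "\<exists>t\<in>{0..<pi}. A * sin t = B * spow q (cos t)" "\<exists>t\<in>{0<..pi}. A * sin t = B * spow q (cos t)"
    by (cases "B = 0"; force intro: bexI [of _ 0] bexI [of _ pi])+
qed

text \<open>
  The shooting family: \<open>Y l\<close> solves the linear-type equation with parameter \<open>l\<close> and the left boundary
  condition, and \<open>\<Theta> l\<close> is its angle at \<open>1\<close>. The right boundary condition holds as soon as \<open>\<Theta> l\<close> hits one of
  the levels \<open>\<tau> + j \<pi>\<close>. Of the behaviour of \<open>\<Theta>\<close> only continuity and a small value for some \<open>l\<close> are
  recorded; large values are obtained later by comparison with given eigenfunctions.
\<close>

lemma shooting:
  fixes A0 B0 A1 B1 :: real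
  assumes p: "p > 1" and q: "continuous_on {0..1} q" and w: "continuous_on {0..1} w"
    and wpos: "\<And>x. x \<in> {0..1} \<Longrightarrow> w x > 0"
    and AB0: "A0 \<noteq> 0 \<or> B0 \<noteq> 0" and AB1: "A1 \<noteq> 0 \<or> B1 \<noteq> 0"
  obtains Y :: "real \<Rightarrow> real \<Rightarrow> real" and \<Theta> :: "real \<Rightarrow> real" and \<tau> :: real
  where "0 < \<tau>" "\<tau> \<le> pi" "continuous_on UNIV \<Theta>" "\<exists>l. \<Theta> l < \<tau>"
    "\<And>l. solves p q w (\<lambda>s. l * spow p s) (Y l)"
    "\<And>l. A0 * Y l 0 = B0 * D01 (Y l) 0"
    "\<And>l. finite {x \<in> {0<..<1}. Y l x = 0}"
    "\<And>l. card {x \<in> {0<..<1}. Y l x = 0} * pi < \<Theta> l"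
    "\<And>l (j::nat). \<Theta> l = \<tau> + j * pi \<Longrightarrow> A1 * Y l 1 = B1 * D01 (Y l) 1"
proof -
  define p' where "p' = p / (p - 1)"
  have p': "p' > 1" using p by (simp add: p'_def)
  obtain \<theta>0 where \<theta>0: "0 \<le> \<theta>0" "\<theta>0 < pi" "A0 * sin \<theta>0 = B0 * spow p' (cos \<theta>0)"
    using boundary_angle_exists(1) [OF p' AB0] by auto
  obtain \<tau> where \<tau>: "0 < \<tau>" "\<tau> \<le> pi" "A1 * sin \<tau> = B1 * spow p' (cos \<tau>)"
    using boundary_angle_exists(2) [OF p' AB1] by auto
  define c where "c = (\<lambda>l x. l * w x - q x)"
  have c: "continuous_on {0..1} (c l)" for l unfolding c_def by (intro continuous_intros q w)
  have "\<exists>\<theta>. \<theta> 0 = \<theta>0 \<and> (\<forall>x\<in>{0..1}. (\<theta> has_real_derivative angle_speed p (c l x) (\<theta> x)) (at x within {0..1}))" for l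
    by (rule prufer_angle_exists [OF p c])
  then obtain \<theta> where \<theta>: "\<And>l. \<theta> l 0 = \<theta>0"
    "\<And>l x. x \<in> {0..1} \<Longrightarrow> (\<theta> l has_real_derivative angle_speed p (c l x) (\<theta> l x)) (at x within {0..1})"
    by metis
  have "\<exists>y r. (\<forall>x. r x > 0 \<and> y x = r x * sin (\<theta> l x)) \<and>
    (\<forall>x\<in>{0..1}. D01 y x = r x * spow p' (cos (\<theta> l x))) \<and> regular p y \<and>
    (\<forall>x\<in>{0<..<1}. deriv (flux p y) x = - (p - 1) * c l x * spow p (y x))" for l
    using prufer_solution [OF p c \<theta>(2)] unfolding p'_def by blast
  then obtain Y r where Y: "\<And>l x. r l x > 0" "\<And>l x. Y l x = r l x * sin (\<theta> l x)"
    "\<And>l x. x \<in> {0..1} \<Longrightarrow> D01 (Y l) x = r l x * spow p' (cos (\<theta> l x))" "\<And>l. regular p (Y l)"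
    "\<And>l x. x \<in> {0<..<1} \<Longrightarrow> deriv (flux p (Y l)) x = - (p - 1) * c l x * spow p (Y l x)"
    by metis
  define \<Theta> where "\<Theta> = (\<lambda>l. \<theta> l 1)"
  have bw: "bounded (w ` {0..1})" "bounded (q ` {0..1})"
    by (intro compact_imp_bounded compact_continuous_image w q; simp)+
  obtain Mw where Mw: "\<And>x. x \<in> {0..1} \<Longrightarrow> \<bar>w x\<bar> \<le> Mw" using bw(1) unfolding bounded_iff by fastforce
  obtain Mq where Mq: "\<And>x. x \<in> {0..1} \<Longrightarrow> \<bar>q x\<bar> \<le> Mq" using bw(2) unfolding bounded_iff by fastforce
  obtain xm where xm: "xm \<in> {0..1}" "\<And>x. x \<in> {0..1} \<Longrightarrow> w xm \<le> w x"
    using continuous_attains_inf [of "{0..1}" w] w by auto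
  have M0: "Mw \<ge> 0" "Mq \<ge> 0" using Mw [of 0] Mq [of 0] by auto
  obtain K where K: "K > 0" "\<And>c z z'. \<bar>angle_speed p c z - angle_speed p c z'\<bar> \<le> K * (1 + \<bar>c\<bar>) * \<bar>z - z'\<bar>"
    using angle_speed_lipschitz [OF p] by blast
  define K' where "K' = (p - 1) / min (p - 1) 1 * Mw"
  have K': "K' \<ge> 0" using p M0 by (simp add: K'_def)
  have dep: "\<bar>\<Theta> l - \<Theta> l'\<bar> \<le> K' * \<bar>l - l'\<bar> * exp (K * (1 + \<bar>l\<bar> * Mw + Mq) + 1)" for l l'
    unfolding \<Theta>_def
  proof (rule gronwall_unit_interval [where ?F1.0 = "\<lambda>x. angle_speed p (c l x)" and ?F2.0 = "\<lambda>x. angle_speed p (c l' x)", OF \<theta>(2) \<theta>(2)])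
    show "\<theta> l 0 = \<theta> l' 0" by (simp add: \<theta>)
    show "0 \<le> K * (1 + \<bar>l\<bar> * Mw + Mq)" "0 \<le> K' * \<bar>l - l'\<bar>" using K M0 K' by auto
    fix t z z' :: real assume t: "t \<in> {0..1}"
    have "\<bar>c l t\<bar> \<le> \<bar>l\<bar> * \<bar>w t\<bar> + \<bar>q t\<bar>" unfolding c_def abs_mult [symmetric] by (rule abs_triangle_ineq4)
    also have "\<dots> \<le> \<bar>l\<bar> * Mw + Mq" using Mw [OF t] Mq [OF t] by (intro add_mono mult_left_mono) auto
    finally have "K * (1 + \<bar>c l t\<bar>) * \<bar>z - z'\<bar> \<le> K * (1 + \<bar>l\<bar> * Mw + Mq) * \<bar>z - z'\<bar>"
      using K(1) by (intro mult_right_mono mult_left_mono) auto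
    then show "\<bar>angle_speed p (c l t) z - angle_speed p (c l t) z'\<bar> \<le> K * (1 + \<bar>l\<bar> * Mw + Mq) * \<bar>z - z'\<bar>"
      using K(2) [of "c l t" z z'] by linarith
    have "c l t - c l' t = (l - l') * w t" by (simp add: c_def algebra_simps)
    then have "\<bar>c l t - c l' t\<bar> \<le> \<bar>l - l'\<bar> * Mw" using Mw [OF t] by (simp add: abs_mult mult_left_mono)
    then have "(p - 1) / min (p - 1) 1 * \<bar>c l t - c l' t\<bar> \<le> (p - 1) / min (p - 1) 1 * (\<bar>l - l'\<bar> * Mw)"
      using p by (intro mult_left_mono) auto
    also have "\<dots> = K' * \<bar>l - l'\<bar>" by (simp add: K'_def)
    finally show "\<bar>angle_speed p (c l t) z - angle_speed p (c l' t) z\<bar> \<le> K' * \<bar>l - l'\<bar>"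
      using angle_speed_diff_le [OF p, of "c l t" z "c l' t"] by linarith
  qed
  have cont: "continuous_on UNIV \<Theta>"
    unfolding continuous_on_eq_continuous_at [OF open_UNIV]
  proof
    fix l
    have "((\<lambda>l'. K' * \<bar>l - l'\<bar> * exp (K * (1 + \<bar>l\<bar> * Mw + Mq) + 1)) \<longlongrightarrow> 0) (at l)"
      by (auto intro!: tendsto_eq_intros)
    then have "((\<lambda>l'. \<Theta> l' - \<Theta> l) \<longlongrightarrow> 0) (at l)"
      by (rule Lim_null_comparison [rotated])
         (use dep [of l] in \<open>auto simp: abs_minus_commute intro!: always_eventually\<close>)
    then show "isCont \<Theta> l" unfolding isCont_def by (simp add: LIM_zero_iff)
  qed
  have low: "\<exists>l. \<Theta> l < \<tau>"
  proof -
    define \<epsilon> where "\<epsilon> = Min {pi / 4, \<tau>, pi - \<theta>0}"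
    have \<epsilon>: "0 < \<epsilon>" "\<epsilon> < pi / 2" "\<epsilon> \<le> \<tau>" "\<theta>0 \<le> pi - \<epsilon>"
      using \<tau> \<theta>0 by (auto simp: \<epsilon>_def min_def)
    \<comment> \<open>The coefficient is \<open>l w - q\<close>, so \<open>l = - C / min w\<close> makes it at most \<open>- C + \<bar>q\<bar>\<close> on the whole interval.\<close>
    define C where "C = \<bar>(1 + pi * p / (p - 1)) / sin \<epsilon> powr p\<bar> + Mq"
    define l where "l = - C / w xm"
    have "C \<ge> 0" using M0 by (simp add: C_def)
    then have "l \<le> 0" using wpos [OF xm(1)] by (simp add: l_def divide_nonpos_pos)
    have "\<theta> l 1 < \<epsilon>"
    proof (rule angle_stays_below [OF p \<epsilon>(1,2) \<theta>(2)])
      show "\<theta> l 0 \<le> pi - \<epsilon>" using \<theta>(1) \<epsilon> by simp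
      fix x :: real assume x: "x \<in> {0..1}"
      have "l * w x \<le> l * w xm" using xm(2) [OF x] \<open>l \<le> 0\<close> by (rule mult_left_mono_neg)
      also have "\<dots> = - C" using wpos [OF xm(1)] by (simp add: l_def)
      finally show "c l x \<le> - (1 + pi * p / (p - 1)) / sin \<epsilon> powr p"
        using Mq [OF x] unfolding c_def C_def minus_divide_left [symmetric] by linarith
    qed
    then show ?thesis using \<epsilon> unfolding \<Theta>_def by (intro exI [of _ l]) simp
  qed
  have Z: "{x \<in> {0<..<1}. Y l x = 0} = {x \<in> {0<..<1}. sin (\<theta> l x) = 0}" for l
    using Y(1) [of l] by (auto simp: Y(2)) (metis order_less_irrefl)
  have zeros: "finite {x \<in> {0<..<1}. Y l x = 0}" "card {x \<in> {0<..<1}. Y l x = 0} * pi < \<Theta> l" for l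
  proof -
    have "\<theta> l 0 \<ge> 0" using \<theta>(1) \<theta>0 by simp
    from card_zeros_less_angle [OF p \<theta>(2) this]
    show "finite {x \<in> {0<..<1}. Y l x = 0}" "card {x \<in> {0<..<1}. Y l x = 0} * pi < \<Theta> l"
      unfolding Z \<Theta>_def by auto
  qed
  have right: "A1 * Y l 1 = B1 * D01 (Y l) 1" if "\<Theta> l = \<tau> + real j * pi" for l j
  proof -
    have th: "\<theta> l 1 = \<tau> + real j * pi" using that by (simp add: \<Theta>_def)
    have "spow p' ((-1) ^ j) = (-1) ^ j"
      by (cases "even j") (auto simp: spow_def)
    then have "D01 (Y l) 1 = r l 1 * (-1) ^ j * spow p' (cos \<tau>)"
      using Y(3) [of 1 l] by (simp add: th cos_add spow_mult)
    moreover have "Y l 1 = r l 1 * (-1) ^ j * sin \<tau>" unfolding Y(2) by (simp add: th sin_add)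
    ultimately show ?thesis using \<tau>(3) by simp
  qed
  have left: "A0 * Y l 0 = B0 * D01 (Y l) 0" for l
    using \<theta>0(3) Y(3) [of 0 l] by (simp add: Y(2) \<theta>)
  have sol: "solves p q w (\<lambda>s. l * spow p s) (Y l)" for l
    unfolding solves_def using Y(4,5) by (simp add: c_def algebra_simps)
  show ?thesis by (rule that [OF \<tau>(1,2) cont low sol left zeros right])
qed

section \<open>The generalized sine at the boundary angles\<close>

abbreviation garcsin_density :: "real \<Rightarrow> real \<Rightarrow> real" where
  "garcsin_density p t \<equiv> 1 / (1 - t powr p) powr (1 / p)"

text \<open>
  The singularity at \<open>1\<close> is dominated by that of \<open>(1 - t)\<^sup>-\<^sup>1\<^sup>/\<^sup>p\<close>, because \<open>t\<^sup>p \<le> t\<close> on \<open>[0,1]\<close>.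
\<close>

lemma garcsin_density_integrable:
  assumes p: "p > 1" shows "garcsin_density p integrable_on {0..1}"
proof (rule measurable_bounded_by_integrable_imp_integrable)
  have "((\<lambda>t. t powr (- 1 / p)) has_integral 1 powr (- 1 / p + 1) / (- 1 / p + 1)) (cbox 0 1)"
    using has_integral_powr_from_0 [of "- 1 / p" 1] p by (simp add: field_simps)
  from has_integral_affinity [OF this, of "- 1" 1]
  show "(\<lambda>t. (1 - t) powr (- 1 / p)) integrable_on {0..1}"
    by (auto simp: integrable_on_def algebra_simps)
  have "garcsin_density p \<in> borel_measurable borel" by measurable
  then show "garcsin_density p \<in> borel_measurable (lebesgue_on {0..1})"
    by (intro measurable_restrict_space1 measurable_completion) simp
  show "norm (garcsin_density p t) \<le> (1 - t) powr (- 1 / p)" if t: "t \<in> {0..1}" for t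
  proof (cases "t = 1")
    case False
    have "t powr p \<le> t powr 1" using t p by (intro powr_mono') auto
    then have "t powr p \<le> t" using t by simp
    then have "(1 - t) powr (1 / p) \<le> (1 - t powr p) powr (1 / p)"
      using t p by (intro powr_mono2) auto
    then have "garcsin_density p t \<le> 1 / (1 - t) powr (1 / p)"
      using t False by (intro divide_left_mono mult_pos_pos) (auto intro: order_less_le_trans [of _ "(1 - t) powr (1 / p)"])
    also have "\<dots> = (1 - t) powr (- 1 / p)" by (simp add: powr_minus_divide)
    finally show ?thesis by simp
  qed simp
qed simp

text \<open>
  The density is at least \<open>1\<close> except at \<open>t = 1\<close>, where division by zero gives it the value \<open>0\<close>; the proof
  changes it at this point. The lemma yields injectivity of \<open>garcsin\<close> and \<open>S\<^sub>p(x) \<le> x\<close> for \<open>0 \<le> x \<le> \<pi>\<^sub>p/2\<close>.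
\<close>

lemma garcsin_diff_ge:
  assumes p: "p > 1" and ab: "0 \<le> a" "a \<le> b" "b \<le> 1"
  shows "b - a \<le> garcsin p b - garcsin p a"
proof -
  define k where "k = (\<lambda>t. if t = 1 then 1 else garcsin_density p t)"
  have I: "garcsin_density p integrable_on {0..b}" "garcsin_density p integrable_on {a..b}"
    using ab by (auto intro: integrable_on_subinterval [OF garcsin_density_integrable [OF p]])
  have "(garcsin_density p has_integral integral {a..b} (garcsin_density p)) {a..b}"
    using I(2) by (rule integrable_integral)
  then have k: "(k has_integral integral {a..b} (garcsin_density p)) {a..b}"
    by (rule has_integral_spike_finite [of "{1}", rotated 2]) (auto simp: k_def)
  have one: "((\<lambda>_. 1) has_integral (b - a)) {a..b}"
    using has_integral_const_real [of "1::real" a b] ab by simp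
  have "b - a \<le> integral {a..b} (garcsin_density p)"
  proof (rule has_integral_le [OF one k])
    fix t assume t: "t \<in> {a..b}"
    show "1 \<le> k t"
    proof (cases "t = 1")
      case False
      have "t powr p < 1 powr p \<or> t = 0" using t ab False p by (intro disjI1 powr_less_mono2) auto
      then have "0 < 1 - t powr p" by auto
      moreover have "(1 - t powr p) powr (1 / p) \<le> 1" using p \<open>0 < 1 - t powr p\<close> by (intro powr_le1) auto
      ultimately show ?thesis using False by (simp add: k_def)
    qed (simp add: k_def)
  qed
  moreover have "garcsin p a + integral {a..b} (garcsin_density p) = garcsin p b"
    unfolding garcsin_def using ab(1,2) I(1) by (rule Henstock_Kurzweil_Integration.integral_combine)
  ultimately show ?thesis by simp
qed

lemma garcsin_0 [simp]: "garcsin p 0 = 0"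
  by (simp add: garcsin_def)

lemma garcsin_1: "garcsin p 1 = gpi p / 2"
proof -
  have "integral {0..1} (\<lambda>t. 2 * garcsin_density p t) = 2 * integral {0..1} (garcsin_density p)"
    by (rule integral_mult_right)
  then show ?thesis by (simp add: garcsin_def gpi_def)
qed

lemma gpi_pos: "p > 1 \<Longrightarrow> gpi p > 0"
  using garcsin_diff_ge [of p 0 1] by (simp add: garcsin_1)

lemma gsin_quarter:
  assumes p: "p > 1" and x: "x \<in> {0..gpi p / 2}"
  shows "gsin_quarter p x \<in> {0..1}" "garcsin p (gsin_quarter p x) = x"
proof -
  have "inj_on (garcsin p) {0..1}"
  proof (rule inj_onI)
    fix a b assume ab: "a \<in> {0..1}" "b \<in> {0..1}" "garcsin p a = garcsin p b"
    show "a = b"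
    proof (rule antisym)
      show "b \<le> a"
      proof (rule ccontr)
        assume "\<not> b \<le> a"
        then have "b - a \<le> garcsin p b - garcsin p a" using ab(1,2) by (intro garcsin_diff_ge [OF p]) auto
        then show False using ab(3) \<open>\<not> b \<le> a\<close> by linarith
      qed
      show "a \<le> b"
      proof (rule ccontr)
        assume "\<not> a \<le> b"
        then have "a - b \<le> garcsin p a - garcsin p b" using ab(1,2) by (intro garcsin_diff_ge [OF p]) auto
        then show False using ab(3) \<open>\<not> a \<le> b\<close> by linarith
      qed
    qed
  qed
  moreover have "continuous_on {0..1} (garcsin p)"
    unfolding garcsin_def using garcsin_density_integrable [OF p] by (rule indefinite_integral_continuous_1)
  then have "x \<in> garcsin p ` {0..1}"
    using IVT' [of "garcsin p" 0 x 1] x by (auto simp: garcsin_1)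
  ultimately show "garcsin p (gsin_quarter p x) = x" "gsin_quarter p x \<in> {0..1}"
    unfolding gsin_quarter_def by (rule f_the_inv_into_f, rule the_inv_into_into) simp
qed

lemma gsin_quarter_0:
  assumes p: "p > 1" shows "gsin_quarter p 0 = 0"
proof -
  have "0 \<in> {0..gpi p / 2}" using gpi_pos [OF p] by simp
  note q = gsin_quarter [OF p this]
  have "gsin_quarter p 0 - 0 \<le> garcsin p (gsin_quarter p 0) - garcsin p 0"
    using q(1) by (intro garcsin_diff_ge p) auto
  then show ?thesis using q by simp
qed

lemma gsin_quarter_quotient:
  assumes p: "p > 1"
  shows "((\<lambda>h. gsin_quarter p \<bar>h\<bar> / \<bar>h\<bar>) \<longlongrightarrow> 1) (at 0)"
proof -
  have "continuous_on {0..1/2} (garcsin_density p)"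
  proof -
    have "0 < 1 - t powr p" if "t \<in> {0..1/2}" for t
    proof -
      have "t powr p < 1 powr p" using that p by (intro powr_less_mono2) auto
      then show ?thesis by simp
    qed
    then show ?thesis using p
      by (intro continuous_intros continuous_on_powr') (auto simp: less_imp_neq [symmetric] less_imp_le)
  qed
  then have "(garcsin p has_real_derivative garcsin_density p 0) (at 0 within {0..1/2})"
    unfolding garcsin_def by (rule integral_has_real_derivative) simp
  then have "((\<lambda>w. garcsin p w / w) \<longlongrightarrow> 1) (at 0 within {0..1/2})"
    by (simp add: has_field_derivative_iff)
  from tendsto_inverse [OF this] have L: "((\<lambda>w. w / garcsin p w) \<longlongrightarrow> 1) (at 0 within {0..1/2})"
    by (simp add: inverse_eq_divide)
  define d where "d = min (1/2) (gpi p / 2)"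
  have d: "d > 0" "d \<le> 1/2" "d \<le> gpi p / 2" using gpi_pos [OF p] by (auto simp: d_def)
  have near: "garcsin p (gsin_quarter p \<bar>h\<bar>) = \<bar>h\<bar>" "gsin_quarter p \<bar>h\<bar> \<in> {0<..\<bar>h\<bar>}"
    if "h \<noteq> 0" "\<bar>h\<bar> < d" for h
  proof -
    have h: "\<bar>h\<bar> \<in> {0..gpi p / 2}" using that d by auto
    show 1: "garcsin p (gsin_quarter p \<bar>h\<bar>) = \<bar>h\<bar>" by (rule gsin_quarter [OF p h])
    have "gsin_quarter p \<bar>h\<bar> \<noteq> 0" using 1 that by auto
    then show "gsin_quarter p \<bar>h\<bar> \<in> {0<..\<bar>h\<bar>}"
      using garcsin_diff_ge [OF p, of 0 "gsin_quarter p \<bar>h\<bar>"] gsin_quarter(1) [OF p h] 1 by auto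
  qed
  have ev: "\<forall>\<^sub>F h in at 0. h \<noteq> 0 \<and> \<bar>h\<bar> < d"
    using d(1) by (auto simp: eventually_at dist_real_def)
  have "((\<lambda>h. gsin_quarter p \<bar>h\<bar>) \<longlongrightarrow> 0) (at 0)"
  proof (rule Lim_null_comparison)
    show "\<forall>\<^sub>F h in at 0. norm (gsin_quarter p \<bar>h\<bar>) \<le> \<bar>h\<bar>"
      using ev
    proof eventually_elim
      case (elim h)
      then show ?case using near(2) [of h] by simp
    qed
    show "((\<lambda>h. \<bar>h\<bar>) \<longlongrightarrow> 0) (at (0::real))" by (auto intro!: tendsto_eq_intros)
  qed
  moreover have "\<forall>\<^sub>F h in at 0. gsin_quarter p \<bar>h\<bar> \<in> {0..1/2} \<and> gsin_quarter p \<bar>h\<bar> \<noteq> 0"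
    using ev
  proof eventually_elim
    case (elim h)
    then show ?case using near(2) [of h] d(2) by simp
  qed
  ultimately have "filterlim (\<lambda>h. gsin_quarter p \<bar>h\<bar>) (at 0 within {0..1/2}) (at 0)"
    by (simp add: filterlim_at)
  from filterlim_compose [OF L this]
  have "((\<lambda>h. gsin_quarter p \<bar>h\<bar> / garcsin p (gsin_quarter p \<bar>h\<bar>)) \<longlongrightarrow> 1) (at 0)" .
  then show ?thesis
  proof (rule Lim_transform_eventually)
    show "\<forall>\<^sub>F h in at 0. gsin_quarter p \<bar>h\<bar> / garcsin p (gsin_quarter p \<bar>h\<bar>) = gsin_quarter p \<bar>h\<bar> / \<bar>h\<bar>"
      using ev
    proof eventually_elim
      case (elim h)
      then show ?case using near(1) [of h] by simp
    qed
  qed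
qed

text \<open>
  Near its zeros \<open>0\<close> and \<open>\<pi>\<^sub>p\<close>, the function \<open>S\<^sub>p\<close> is, up to sign, the odd extension of the inverse of
  \<open>garcsin\<close>. This unfolds the piecewise definition with its periodic reduction.
\<close>

lemma gsin_near:
  assumes p: "p > 1" and h: "\<bar>h\<bar> < gpi p / 2"
  shows "gsin p h = sgn h * gsin_quarter p \<bar>h\<bar>" "gsin p (gpi p + h) = - sgn h * gsin_quarter p \<bar>h\<bar>"
proof -
  note g = gpi_pos [OF p]
  have 1: "h rmod (2 * gpi p) = (if h < 0 then h + 2 * gpi p else h)"
    by (rule rmod_unique [of _ _ _ "if h < 0 then - 1 else 0"]) (use h g in auto)
  have 2: "(gpi p + h) rmod (2 * gpi p) = gpi p + h"
    by (rule rmod_unique [of _ _ _ 0]) (use h g in auto)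
  show "gsin p h = sgn h * gsin_quarter p \<bar>h\<bar>"
    unfolding gsin_def Let_def 1 gsin_half_def using h g gsin_quarter_0 [OF p] by (auto simp: sgn_if)
  show "gsin p (gpi p + h) = - sgn h * gsin_quarter p \<bar>h\<bar>"
    unfolding gsin_def Let_def 2 gsin_half_def using h g gsin_quarter_0 [OF p] by (auto simp: sgn_if)
qed

text \<open>
  The only property of the generalized sine that the boundary conditions need: \<open>S\<^sub>p\<close> and \<open>S\<^sub>p'\<close> have no
  common zero, so both conditions are genuine linear relations between \<open>y\<close> and \<open>y'\<close>. Inside \<open>(0, \<pi>\<^sub>p)\<close> the
  value of \<open>S\<^sub>p\<close> is nonzero, and at the ends its derivative is \<open>1\<close> or \<open>- 1\<close>.
\<close>

lemma gsin_nondegenerate: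
  assumes p: "p > 1" and x: "x \<in> {0..gpi p}"
  shows "deriv (gsin p) x \<noteq> 0 \<or> gsin p x \<noteq> 0"
proof -
  note g = gpi_pos [OF p]
  have ev: "\<forall>\<^sub>F h in at 0. h \<noteq> 0 \<and> \<bar>h\<bar> < gpi p / 2"
    using g by (auto simp: eventually_at dist_real_def intro!: exI [of _ "gpi p / 2"])
  have D: "(gsin p has_real_derivative s) (at c)"
    if c: "\<And>h. \<bar>h\<bar> < gpi p / 2 \<Longrightarrow> gsin p (c + h) = s * (sgn h * gsin_quarter p \<bar>h\<bar>)" for c s
  proof -
    have "((\<lambda>h. s * (gsin_quarter p \<bar>h\<bar> / \<bar>h\<bar>)) \<longlongrightarrow> s * 1) (at 0)"
      by (intro tendsto_intros gsin_quarter_quotient p)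
    then have "((\<lambda>h. (gsin p (c + h) - gsin p c) / h) \<longlongrightarrow> s * 1) (at 0)"
    proof (rule Lim_transform_eventually)
      have 0: "gsin p c = 0" using c [of 0] g by simp
      show "\<forall>\<^sub>F h in at 0. s * (gsin_quarter p \<bar>h\<bar> / \<bar>h\<bar>) = (gsin p (c + h) - gsin p c) / h"
        using ev
      proof eventually_elim
        case (elim h)
        then show ?case using 0 c [of h] by (simp add: sgn_if)
      qed
    qed
    then show ?thesis by (simp add: DERIV_def)
  qed
  consider "x = 0" | "x = gpi p" | "0 < x" "x < gpi p" using x by fastforce
  then show ?thesis
  proof cases
    case 1
    have "(gsin p has_real_derivative 1) (at 0)" by (rule D) (simp add: gsin_near [OF p])
    then show ?thesis using 1 by (simp add: DERIV_imp_deriv)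
  next
    case 2
    have "(gsin p has_real_derivative - 1) (at (gpi p))" by (rule D) (simp add: gsin_near [OF p])
    then show ?thesis using 2 by (simp add: DERIV_imp_deriv)
  next
    case 3
    have "gsin_quarter p z \<noteq> 0" if "0 < z" "z \<le> gpi p / 2" for z
      using gsin_quarter(2) [OF p, of z] that by auto
    moreover have "x rmod (2 * gpi p) = x" using 3 by (intro rmod_idem) auto
    ultimately show ?thesis using 3 by (auto simp: gsin_def gsin_half_def)
  qed
qed

section \<open>Sturm comparison of solutions\<close>

abbreviation interior_zeros :: "(real \<Rightarrow> real) \<Rightarrow> real set" where
  "interior_zeros y \<equiv> {x \<in> {0<..<1}. y x = 0}"

lemma nontrivial_if_finite_zeros:
  assumes "finite (interior_zeros y)" shows "nontrivial y"
proof (rule ccontr)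
  assume "\<not> nontrivial y"
  then have "{0<..<1} \<subseteq> interior_zeros y" by (auto simp: nontrivial_def)
  then have "finite {0<..<1::real}" using assms by (rule finite_subset)
  then show False by (simp add: infinite_Ioo)
qed

lemma cond_C1_D:
  assumes "cond_C1 q w"
  shows "continuous_on {0..1} q" "continuous_on {0..1} w" "\<And>x. x \<in> {0..1} \<Longrightarrow> w x > 0"
  using assms C1_01_continuous by (auto simp: cond_C1_def)

lemma wronskian_zero_if_same_boundary_condition:
  fixes A B :: real
  assumes "A \<noteq> 0 \<or> B \<noteq> 0" "A * u = B * u'" "A * y = B * y'"
  shows "u * y' = y * u'"
proof (cases "B = 0")
  case False
  then have "u' = A * u / B" "y' = A * y / B" using assms by (auto simp: field_simps)
  then show ?thesis by simp
qed (use assms in auto)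

lemma simple_zeros_if_bounded_ratio:
  assumes p: "p > 1" and C1: "cond_C1 q w" and y: "solves p q w F y" "nontrivial y"
    and F: "\<And>s. \<bar>F s\<bar> \<le> M * \<bar>s\<bar> powr (p - 1)" and e: "e \<in> {0..1}"
  shows "y e \<noteq> 0 \<or> D01 y e \<noteq> 0"
proof -
  have reg: "regular p y" using y by (simp add: solves_def)
  note cw = cond_C1_D [OF C1]
  have "bounded (w ` {0..1})" "bounded (q ` {0..1})"
    by (intro compact_imp_bounded compact_continuous_image cw; simp)+
  then obtain Mw Mq where M: "\<And>x. x \<in> {0..1} \<Longrightarrow> \<bar>w x\<bar> \<le> Mw" "\<And>x. x \<in> {0..1} \<Longrightarrow> \<bar>q x\<bar> \<le> Mq"
    unfolding bounded_iff by fastforce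
  have nn: "Mw \<ge> 0" "Mq \<ge> 0" "M \<ge> 0" using M(1) [of 0] M(2) [of 0] F [of 1] by auto
  show ?thesis
  proof (rule simple_zeros_if_bounded [OF p reg y(2) _ _ e])
    show "0 \<le> (p - 1) * (Mq + Mw * M)" using p nn by simp
    fix x :: real assume x: "x \<in> {0<..<1}"
    then have x1: "x \<in> {0..1}" by auto
    define a where "a = \<bar>y x\<bar> powr (p - 1)"
    have "deriv (flux p y) x = (p - 1) * (q x * spow p (y x) - w x * F (y x))"
      using y x by (simp add: solves_def)
    then have ode: "\<bar>deriv (flux p y) x\<bar> = (p - 1) * \<bar>q x * spow p (y x) - w x * F (y x)\<bar>"
      using p by (simp add: abs_mult)
    have "\<bar>q x * spow p (y x) - w x * F (y x)\<bar> \<le> \<bar>q x\<bar> * a + \<bar>w x\<bar> * \<bar>F (y x)\<bar>"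
      unfolding a_def abs_spow [symmetric] abs_mult [symmetric] by (rule abs_triangle_ineq4)
    also have "\<dots> \<le> Mq * a + Mw * (M * a)"
      using M(1) [OF x1] M(2) [OF x1] F [of "y x"] nn
      unfolding a_def by (intro add_mono mult_mono) auto
    finally have "(p - 1) * \<bar>q x * spow p (y x) - w x * F (y x)\<bar> \<le> (p - 1) * (Mq * a + Mw * (M * a))"
      by (rule mult_left_mono) (use p in simp)
    then show "\<bar>deriv (flux p y) x\<bar> \<le> (p - 1) * (Mq + Mw * M) * \<bar>y x\<bar> powr (p - 1)"
      unfolding ode a_def by (simp only: distrib_right mult.assoc)
  qed
qed

lemma simple_zeros_linear:
  assumes "p > 1" "cond_C1 q w" "solves p q w (\<lambda>s. l * spow p s) y" "nontrivial y" "e \<in> {0..1}"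
  shows "y e \<noteq> 0 \<or> D01 y e \<noteq> 0"
  by (rule simple_zeros_if_bounded_ratio [OF assms(1-4) _ assms(5), of "\<bar>l\<bar>"]) (simp add: abs_mult abs_spow)

text \<open>
  For \<open>F\<close> with the sign of its argument the term \<open>- w F(y)\<close> only pushes \<open>y\<close> towards zero, so the
  one-sided bound on the flux derivative comes from \<open>q\<close> alone. This covers nonlinearities for which
  \<open>F(s)/s\<^sup>p\<^sup>-\<^sup>1\<close> is unbounded.
\<close>

lemma simple_zeros_if_sign_preserving:
  assumes p: "p > 1" and C1: "cond_C1 q w" and y: "solves p q w F y" "finite (interior_zeros y)"
    and F: "\<And>s. 0 \<le> sgn s * F s" and e: "e \<in> {0..1}"
  shows "y e \<noteq> 0 \<or> D01 y e \<noteq> 0"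
proof -
  have reg: "regular p y" using y by (simp add: solves_def)
  note cw = cond_C1_D [OF C1]
  have "bounded (q ` {0..1})"
    by (intro compact_imp_bounded compact_continuous_image cw; simp)+
  then obtain Mq where M: "\<And>x. x \<in> {0..1} \<Longrightarrow> \<bar>q x\<bar> \<le> Mq" unfolding bounded_iff by fastforce
  have nn: "Mq \<ge> 0" using M [of 0] by auto
  show ?thesis
  proof (rule simple_zeros_if_finite [OF p reg y(2) _ _ e])
    show "0 \<le> (p - 1) * Mq" using p nn by simp
    fix x :: real assume x: "x \<in> {0<..<1}"
    then have x1: "x \<in> {0..1}" by auto
    have ode: "deriv (flux p y) x = (p - 1) * (q x * spow p (y x) - w x * F (y x))"
      using y x by (simp add: solves_def)
    have sp: "sgn (y x) * spow p (y x) = \<bar>y x\<bar> powr (p - 1)" by (simp add: spow_def sgn_if)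
    have "q x * \<bar>y x\<bar> powr (p - 1) - w x * (sgn (y x) * F (y x)) \<le> Mq * \<bar>y x\<bar> powr (p - 1) - 0"
      using M [OF x1] mult_nonneg_nonneg [OF less_imp_le [OF cw(3) [OF x1]] F [of "y x"]]
      by (intro diff_mono mult_right_mono) auto
    then have "(p - 1) * (q x * \<bar>y x\<bar> powr (p - 1) - w x * (sgn (y x) * F (y x))) \<le> (p - 1) * (Mq * \<bar>y x\<bar> powr (p - 1))"
      using p by (intro mult_left_mono) auto
    moreover have "sgn (y x) * deriv (flux p y) x = (p - 1) * (q x * \<bar>y x\<bar> powr (p - 1) - w x * (sgn (y x) * F (y x)))"
      unfolding ode sp [symmetric] by (simp add: algebra_simps)
    ultimately show "sgn (y x) * deriv (flux p y) x \<le> (p - 1) * Mq * \<bar>y x\<bar> powr (p - 1)"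
      by (simp only: mult.assoc)
  qed
qed

text \<open>
  Sturm comparison: both functions solve a half-linear equation with potential \<open>w F(u)/u\<^sup>(\<^sup>p\<^sup>-\<^sup>1\<^sup>) - q\<close> and
  \<open>w G(y)/y\<^sup>(\<^sup>p\<^sup>-\<^sup>1\<^sup>) - q\<close>, and the second is larger wherever both are defined.
\<close>

lemma sturm_comparison_nodes:
  assumes p: "p > 1" and C1: "cond_C1 q w" and u: "solves p q w F u" and y: "solves p q w G y"
    and FG: "\<And>s t. s \<noteq> 0 \<Longrightarrow> t \<noteq> 0 \<Longrightarrow> F s / spow p s < G t / spow p t"
    and simple: "\<And>e. e \<in> {0..1} \<Longrightarrow> u e \<noteq> 0 \<or> D01 u e \<noteq> 0"
       "\<And>e. e \<in> {0..1} \<Longrightarrow> y e \<noteq> 0 \<or> D01 y e \<noteq> 0"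
    and E: "finite E" "E \<subseteq> {0..1}"
    and node: "\<And>e. e \<in> E \<Longrightarrow> u e = 0 \<or> u e * D01 y e = y e * D01 u e"
  shows "\<exists>Y \<subseteq> interior_zeros y. finite Y \<and> card Y = card E - 1"
proof (rule zeros_separate_nodes [OF p _ _ simple(2,1) _ E node])
  show "regular p u" "regular p y" using u y by (auto simp: solves_def)
  fix x :: real assume x: "x \<in> {0<..<1}" and nz: "u x \<noteq> 0" "y x \<noteq> 0"
  have "F (u x) * u x = F (u x) / spow p (u x) * \<bar>u x\<bar> powr p"
    using nz by (simp add: mult_spow [symmetric])
  also have "\<dots> < G (y x) / spow p (y x) * \<bar>u x\<bar> powr p"
    using FG [OF nz] nz by (intro mult_strict_right_mono) auto
  finally have "w x * (F (u x) * u x) < w x * (G (y x) / spow p (y x) * \<bar>u x\<bar> powr p)"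
    using cond_C1_D(3) [OF C1, of x] x by (intro mult_strict_left_mono) auto
  then have "(p - 1) * (q x * \<bar>u x\<bar> powr p - w x * (G (y x) / spow p (y x) * \<bar>u x\<bar> powr p))
      < (p - 1) * (q x * \<bar>u x\<bar> powr p - w x * (F (u x) * u x))"
    using p by (intro mult_strict_left_mono) auto
  moreover have "\<bar>u x\<bar> powr p * deriv (flux p y) x / spow p (y x) =
      (p - 1) * (q x * \<bar>u x\<bar> powr p - w x * (G (y x) / spow p (y x) * \<bar>u x\<bar> powr p))"
  proof -
    have ode: "deriv (flux p y) x = (p - 1) * (q x * spow p (y x) - w x * G (y x))"
      using y x by (simp add: solves_def)
    show ?thesis unfolding ode using nz by (simp add: field_simps)
  qed
  moreover have "u x * deriv (flux p u) x = (p - 1) * (q x * \<bar>u x\<bar> powr p - w x * (F (u x) * u x))"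
  proof -
    have "deriv (flux p u) x = (p - 1) * (q x * spow p (u x) - w x * F (u x))"
      using u x by (simp add: solves_def)
    then show ?thesis by (simp only: mult_spow [symmetric]) (simp add: algebra_simps)
  qed
  ultimately show "\<bar>u x\<bar> powr p * deriv (flux p y) x / spow p (y x) < u x * deriv (flux p u) x"
    by simp
qed

text \<open>
  Common boundary conditions turn both end points into nodes, which gives one more zero for \<open>y\<close> than
  for \<open>u\<close>.
\<close>

lemma sturm_comparison_bvp:
  assumes p: "p > 1" and \<alpha>: "\<alpha> \<in> {0..gpi p}" and \<beta>: "\<beta> \<in> {0..gpi p}" and C1: "cond_C1 q w"
    and u: "bvp_solution p \<alpha> \<beta> q w F u" and y: "bvp_solution p \<alpha> \<beta> q w G y"
    and FG: "\<And>s t. s \<noteq> 0 \<Longrightarrow> t \<noteq> 0 \<Longrightarrow> F s / spow p s < G t / spow p t"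
    and simple: "\<And>e. e \<in> {0..1} \<Longrightarrow> u e \<noteq> 0 \<or> D01 u e \<noteq> 0"
       "\<And>e. e \<in> {0..1} \<Longrightarrow> y e \<noteq> 0 \<or> D01 y e \<noteq> 0"
    and X: "finite X" "X \<subseteq> interior_zeros u"
  shows "\<exists>Y \<subseteq> interior_zeros y. finite Y \<and> card Y = card X + 1"
proof -
  have us: "solves p q w F u" and ys: "solves p q w G y"
    and bc: "boundary_conditions p \<alpha> \<beta> u" "boundary_conditions p \<alpha> \<beta> y"
    using u y by (auto simp: bvp_solution_iff)
  have 0: "u 0 * D01 y 0 = y 0 * D01 u 0"
    by (rule wronskian_zero_if_same_boundary_condition [OF gsin_nondegenerate [OF p \<alpha>]])
       (use bc in \<open>auto simp: boundary_conditions_def\<close>)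
  have 1: "u 1 * D01 y 1 = y 1 * D01 u 1"
    by (rule wronskian_zero_if_same_boundary_condition [OF gsin_nondegenerate [OF p \<beta>]])
       (use bc in \<open>auto simp: boundary_conditions_def\<close>)
  have "\<exists>Y \<subseteq> interior_zeros y. finite Y \<and> card Y = card (insert 0 (insert 1 X)) - 1"
    by (rule sturm_comparison_nodes [OF p C1 us ys FG simple]) (use X 0 1 in auto)
  moreover have "card (insert 0 (insert 1 X)) = card X + 2"
    using X by (subst card_insert_disjoint; (subst card_insert_disjoint)?) auto
  ultimately show ?thesis by simp
qed

section \<open>Zeros of eigenfunctions\<close>

lemma eigenfunction_bvp:
  assumes "eigenfunction p \<alpha> \<beta> q w l y"
  shows "bvp_solution p \<alpha> \<beta> q w (\<lambda>s. l * spow p s) y" "nontrivial y" "solves p q w (\<lambda>s. l * spow p s) y"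
  using assms by (auto simp: eigenfunction_iff bvp_solution_iff)

text \<open>
  The hypotheses provide the eigenvalues in increasing order but not the number of zeros of their
  eigenfunctions. The next lemmas show that every eigenfunction of \<open>lam n\<close> has at least \<open>n\<close> zeros and that
  some eigenfunction has at most \<open>n\<close>.
\<close>

context
  fixes p \<alpha> \<beta> :: real and q w :: "real \<Rightarrow> real" and lam :: "nat \<Rightarrow> real"
  assumes p: "p > 1" and \<alpha>: "\<alpha> \<in> {0..gpi p}" and \<beta>: "\<beta> \<in> {0..gpi p}" and C1: "cond_C1 q w"
    and lam_mono: "strict_mono lam" and lam_range: "range lam = {l. eigenvalue p \<alpha> \<beta> q w l}"
begin

lemma eigenfunctions_compare:
  assumes u: "eigenfunction p \<alpha> \<beta> q w l u" and y: "eigenfunction p \<alpha> \<beta> q w m y" and "l < m"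
    and X: "finite X" "X \<subseteq> interior_zeros u"
  shows "\<exists>Y \<subseteq> interior_zeros y. finite Y \<and> card Y = card X + 1"
  by (rule sturm_comparison_bvp [OF p \<alpha> \<beta> C1 eigenfunction_bvp(1) [OF u] eigenfunction_bvp(1) [OF y] _
        simple_zeros_linear [OF p C1 eigenfunction_bvp(3,2) [OF u]]
        simple_zeros_linear [OF p C1 eigenfunction_bvp(3,2) [OF y]] X])
     (use \<open>l < m\<close> in auto)

lemma eigenfunction_exists: "\<exists>u. eigenfunction p \<alpha> \<beta> q w (lam n) u"
  using lam_range by (auto simp: eigenvalue_def)

text \<open>
  By induction, since each step from \<open>lam n\<close> to \<open>lam (Suc n)\<close> gains a zero. The statement is about finite
  subsets because finiteness of the set of zeros is not yet available.
\<close>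

lemma eigenfunction_many_zeros:
  assumes "eigenfunction p \<alpha> \<beta> q w (lam n) u"
  shows "\<exists>X \<subseteq> interior_zeros u. finite X \<and> card X = n"
  using assms
proof (induction n arbitrary: u)
  case 0
  then show ?case by (intro exI [of _ "{}"]) simp
next
  case (Suc n)
  obtain v where v: "eigenfunction p \<alpha> \<beta> q w (lam n) v" using eigenfunction_exists by blast
  obtain X where "X \<subseteq> interior_zeros v" "finite X" "card X = n" using Suc.IH [OF v] by blast
  then show ?case
    using eigenfunctions_compare [OF v Suc.prems, of X] lam_mono by (auto simp: strict_mono_def)
qed

text \<open>
  Without boundary conditions for \<open>y\<close>, only the zeros of the eigenfunction serve as nodes, and one zero is
  lost.
\<close>

lemma index_le_card_zeros_of_larger_parameter:
  assumes y: "solves p q w (\<lambda>s. l * spow p s) y" "nontrivial y" and l: "lam n < l"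
    and fin: "finite (interior_zeros y)"
  shows "n \<le> card (interior_zeros y) + 1"
proof -
  obtain u where u: "eigenfunction p \<alpha> \<beta> q w (lam n) u" using eigenfunction_exists by blast
  obtain X where X: "X \<subseteq> interior_zeros u" "finite X" "card X = n"
    using eigenfunction_many_zeros [OF u] by blast
  have "\<exists>Y \<subseteq> interior_zeros y. finite Y \<and> card Y = card X - 1"
    by (rule sturm_comparison_nodes [OF p C1 eigenfunction_bvp(3) [OF u] y(1) _
          simple_zeros_linear [OF p C1 eigenfunction_bvp(3,2) [OF u]]
          simple_zeros_linear [OF p C1 y]]) (use X l in auto)
  then have "n - 1 \<le> card (interior_zeros y)"
    unfolding X(3) using card_mono [OF fin] by metis
  then show ?thesis by simp
qed

text \<open>
  The angle \<open>\<Theta>\<close> at the right end passes every level \<open>\<tau> + j \<pi>\<close>: it is below \<open>\<tau>\<close> somewhere, and it is large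
  wherever the parameter exceeds a high eigenvalue, because the shooting solution then has many zeros.
  This gives distinct eigenvalues \<open>\<mu> j\<close> with eigenfunctions having at most \<open>j\<close> zeros. If none of
  \<open>\<mu> 0, \<dots>, \<mu> n\<close> were \<open>lam n\<close>, then comparison would exclude \<open>lam n < \<mu> j\<close>, and \<open>n + 1\<close> different eigenvalues
  would lie below \<open>lam n\<close>, where there are only \<open>n\<close>.
\<close>

lemma
  shows eigenvalues_unbounded: "\<exists>n. M \<le> lam n"
    and eigenfunction_few_zeros: "\<exists>u. eigenfunction p \<alpha> \<beta> q w (lam n) u \<and> finite (interior_zeros u) \<and> card (interior_zeros u) \<le> n"
proof -
  note cw = cond_C1_D [OF C1]
  obtain Y \<Theta> \<tau> where \<tau>: "0 < \<tau>" "\<tau> \<le> pi" and cont: "continuous_on UNIV \<Theta>" and low: "\<exists>l. \<Theta> l < \<tau>"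
    and sol: "\<And>l. solves p q w (\<lambda>s. l * spow p s) (Y l)"
    and left: "\<And>l. deriv (gsin p) \<alpha> * Y l 0 = gsin p \<alpha> * D01 (Y l) 0"
    and fin: "\<And>l. finite (interior_zeros (Y l))"
    and card: "\<And>l. card (interior_zeros (Y l)) * pi < \<Theta> l"
    and right: "\<And>l (j::nat). \<Theta> l = \<tau> + j * pi \<Longrightarrow> deriv (gsin p) \<beta> * Y l 1 = gsin p \<beta> * D01 (Y l) 1"
    by (rule shooting [OF p cw gsin_nondegenerate [OF p \<alpha>] gsin_nondegenerate [OF p \<beta>]], assumption) (rule that; assumption)
  have nt: "nontrivial (Y l)" for l by (rule nontrivial_if_finite_zeros [OF fin])
  show "\<exists>n. M \<le> lam n"
  proof (rule ccontr)
    assume "\<not> ?thesis"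
    then have "lam (card (interior_zeros (Y M)) + 2) < M" by (simp add: not_le)
    from index_le_card_zeros_of_larger_parameter [OF sol nt this fin] show False by simp
  qed
  have "\<exists>l. \<Theta> l = \<tau> + j * pi" for j :: nat
  proof -
    obtain l0 where "\<Theta> l0 < \<tau>" using low by blast
    then have l0: "\<Theta> l0 \<le> \<tau> + j * pi" by (simp add: add_increasing2)
    \<comment> \<open>The index is shifted by two because one zero is lost in the comparison and \<open>\<tau>\<close> may be \<open>\<pi>\<close>.\<close>
    define l1 where "l1 = lam (j + 2) + 1"
    have "j + 1 \<le> card (interior_zeros (Y l1))"
      using index_le_card_zeros_of_larger_parameter [OF sol nt _ fin, of "j + 2" l1] by (simp add: l1_def)
    then have "real (j + 1) * pi \<le> card (interior_zeros (Y l1)) * pi" by (intro mult_right_mono) auto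
    then have l1: "\<tau> + j * pi \<le> \<Theta> l1" using card [of l1] \<tau> by (simp add: algebra_simps)
    show ?thesis
      using IVT' [of \<Theta> l0 _ l1, OF l0 l1] IVT2' [of \<Theta> l0 _ l1, OF l0 l1] continuous_on_subset [OF cont]
      by (cases "l0 \<le> l1") fastforce+
  qed
  then obtain \<mu> :: "nat \<Rightarrow> real" where \<mu>: "\<And>j::nat. \<Theta> (\<mu> j) = \<tau> + j * pi" by metis
  have eig: "eigenfunction p \<alpha> \<beta> q w (\<mu> j) (Y (\<mu> j))" for j
    unfolding eigenfunction_iff boundary_conditions_def
    using nt sol left right [OF \<mu>] by simp
  have few: "card (interior_zeros (Y (\<mu> j))) \<le> j" for j
  proof -
    have "card (interior_zeros (Y (\<mu> j))) * pi < (1 + real j) * pi"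
      using card [of "\<mu> j"] \<mu> [of j] \<tau>(2) by (simp add: algebra_simps)
    then have "real (card (interior_zeros (Y (\<mu> j)))) < 1 + real j" by simp
    then show ?thesis by linarith
  qed
  have "inj \<mu>"
  proof (rule injI)
    fix i j assume "\<mu> i = \<mu> j"
    then have "\<tau> + i * pi = \<tau> + j * pi" using \<mu> by metis
    then show "i = j" by simp
  qed
  have "\<exists>j\<le>n. \<mu> j = lam n"
  proof (rule ccontr)
    assume none: "\<not> ?thesis"
    have lt: "\<mu> j < lam n" if "j \<le> n" for j
    proof (rule ccontr)
      assume "\<not> \<mu> j < lam n"
      then have gt: "lam n < \<mu> j" using none that by force
      obtain u where u: "eigenfunction p \<alpha> \<beta> q w (lam n) u" using eigenfunction_exists by blast
      obtain X where X: "X \<subseteq> interior_zeros u" "finite X" "card X = n"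
        using eigenfunction_many_zeros [OF u] by blast
      obtain Z where "Z \<subseteq> interior_zeros (Y (\<mu> j))" "card Z = n + 1"
        using eigenfunctions_compare [OF u eig gt X(2,1)] X(3) by blast
      then have "n + 1 \<le> card (interior_zeros (Y (\<mu> j)))" using card_mono [OF fin] by metis
      then show False using few [of j] that by linarith
    qed
    have "\<exists>k. \<mu> j = lam k" for j
      using eig lam_range by (metis (mono_tags, lifting) eigenvalue_def mem_Collect_eq rangeE)
    then obtain k where k: "\<And>j. \<mu> j = lam (k j)" by metis
    have "inj k" using \<open>inj \<mu>\<close> k by (auto simp: inj_def)
    have "k ` {..n} \<subseteq> {..<n}"
      using lt k lam_mono by (auto simp: strict_mono_less)
    then have "card (k ` {..n}) \<le> card {..<n}" by (intro card_mono) auto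
    then show False using card_image [of k "{..n}"] \<open>inj k\<close> by (simp add: inj_on_subset)
  qed
  then obtain j where j: "j \<le> n" "\<mu> j = lam n" by blast
  then show "\<exists>u. eigenfunction p \<alpha> \<beta> q w (lam n) u \<and> finite (interior_zeros u) \<and> card (interior_zeros u) \<le> n"
    using eig [of j] few [of j] fin [of "\<mu> j"] by (intro exI [of _ "Y (\<mu> j)"]) auto
qed

lemma bvp_few_zeros:
  assumes y: "bvp_solution p \<alpha> \<beta> q w f y" and simple: "\<And>e. e \<in> {0..1} \<Longrightarrow> y e \<noteq> 0 \<or> D01 y e \<noteq> 0"
    and less: "\<And>s. s \<noteq> 0 \<Longrightarrow> f s / spow p s < lam n"
    and X: "finite X" "X \<subseteq> interior_zeros y"
  shows "card X < n"
proof -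
  obtain u where u: "eigenfunction p \<alpha> \<beta> q w (lam n) u" and fin: "finite (interior_zeros u)"
    and few: "card (interior_zeros u) \<le> n"
    using eigenfunction_few_zeros by blast
  have "\<exists>Y \<subseteq> interior_zeros u. finite Y \<and> card Y = card X + 1"
    by (rule sturm_comparison_bvp [OF p \<alpha> \<beta> C1 y eigenfunction_bvp(1) [OF u] _ simple
          simple_zeros_linear [OF p C1 eigenfunction_bvp(3,2) [OF u]] X]) (use less in auto)
  then have "card X + 1 \<le> card (interior_zeros u)" using card_mono [OF fin] by metis
  then show ?thesis using few by simp
qed

lemma bvp_many_zeros:
  assumes y: "bvp_solution p \<alpha> \<beta> q w f y" and simple: "\<And>e. e \<in> {0..1} \<Longrightarrow> y e \<noteq> 0 \<or> D01 y e \<noteq> 0"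
    and less: "\<And>s. s \<noteq> 0 \<Longrightarrow> lam n < f s / spow p s"
  shows "\<exists>X \<subseteq> interior_zeros y. finite X \<and> card X = n + 1"
proof -
  obtain u where u: "eigenfunction p \<alpha> \<beta> q w (lam n) u" using eigenfunction_exists by blast
  obtain X where X: "X \<subseteq> interior_zeros u" "finite X" "card X = n"
    using eigenfunction_many_zeros [OF u] by blast
  have "\<exists>Y \<subseteq> interior_zeros y. finite Y \<and> card Y = card X + 1"
    by (rule sturm_comparison_bvp [OF p \<alpha> \<beta> C1 eigenfunction_bvp(1) [OF u] y _
          simple_zeros_linear [OF p C1 eigenfunction_bvp(3,2) [OF u]] simple X(2,1)]) (use less in auto)
  then show ?thesis using X(3) by simp
qed

end

section \<open>Nonlinear boundary value problems\<close>

lemma cond_C2_0: assumes "cond_C2 f" shows "f 0 = 0"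
proof -
  have c: "isCont f 0" using assms by (simp add: cond_C2_def continuous_on_eq_continuous_at)
  have "(f \<longlongrightarrow> f 0) (at_right 0)" using c by (meson isCont_def tendsto_within_subset top_greatest)
  moreover have "((\<lambda>s. - f (- s)) \<longlongrightarrow> - f 0) (at_right 0)"
  proof -
    have "isCont (\<lambda>s. - f (- s)) 0" using c by (intro continuous_intros isCont_o2 [of 0 uminus f]) auto
    then have "((\<lambda>s. - f (- s)) \<longlongrightarrow> - f (- 0)) (at 0)" unfolding isCont_def .
    then show ?thesis using tendsto_within_subset [of _ _ 0 UNIV "{0<..}"] by simp
  qed
  then have "(f \<longlongrightarrow> - f 0) (at_right 0)"
    by (rule Lim_transform_eventually)
       (use assms in \<open>auto simp: cond_C2_def eventually_at_right_less eventually_at_filter\<close>)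
  ultimately have "f 0 = - f 0" by (intro tendsto_unique) (auto simp: trivial_limit_at_right_real)
  then show ?thesis by simp
qed

lemma cond_C2_ratio:
  assumes "cond_C2 f" "s \<noteq> 0"
  shows "f s / spow p s = f \<bar>s\<bar> / \<bar>s\<bar> powr (p - 1)"
proof (cases "s > 0")
  case False
  then have "f s = - f (- s)" using assms by (metis cond_C2_def linorder_neqE_linordered_idom minus_minus neg_0_less_iff_less)
  then show ?thesis using False assms(2) by (simp add: spow_def)
qed (simp add: spow_def)

theorem theorem1p1:
  fixes p \<alpha> \<beta> :: real and q w f :: "real \<Rightarrow> real" and lam :: "nat \<Rightarrow> real"
  assumes p: "p > 1"
    and \<alpha>: "\<alpha> \<in> {0..<gpi p}"
    and \<beta>: "\<beta> \<in> {0<..gpi p}"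
    and C1: "cond_C1 q w"
    and C2: "cond_C2 f"
    and C3: "cond_C3 p f"
    and lam_mono: "strict_mono lam"
    and lam_range: "range lam = {l. eigenvalue p \<alpha> \<beta> q w l}"
  shows
    "(\<forall>n. (\<forall>s>0. f s / s powr (p - 1) < lam n) \<longrightarrow>
        (\<forall>i\<ge>n. \<not> (\<exists>y. bvp_solution p \<alpha> \<beta> q w f y \<and> has_exactly_zeros i y))) \<and>
     (\<forall>n. (\<forall>s>0. lam n < f s / s powr (p - 1)) \<longrightarrow>
        (\<forall>i\<le>n. \<not> (\<exists>y. bvp_solution p \<alpha> \<beta> q w f y \<and> has_exactly_zeros i y))) \<and>
     ((\<forall>n. \<forall>s>0. f s / s powr (p - 1) \<noteq> lam n) \<longrightarrow>
        \<not> (\<exists>y. bvp_solution p \<alpha> \<beta> q w f y \<and> nontrivial y))"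
proof -
  define g where "g = (\<lambda>s. f s / s powr (p - 1))"
  have \<alpha>': "\<alpha> \<in> {0..gpi p}" and \<beta>': "\<beta> \<in> {0..gpi p}" using \<alpha> \<beta> by auto
  note eig = p \<alpha>' \<beta>' C1 lam_mono lam_range
  have f0: "f 0 = 0" by (rule cond_C2_0 [OF C2])
  have fpos: "f s > 0" if "s > 0" for s using C2 that by (simp add: cond_C2_def)
  have ratio: "f s / spow p s = g \<bar>s\<bar>" if "s \<noteq> 0" for s
    unfolding g_def by (rule cond_C2_ratio [OF C2 that])
  have gpos: "g s > 0" if "s > 0" for s using fpos that by (simp add: g_def)
  have f_eq: "f s = g \<bar>s\<bar> * spow p s" for s
    using ratio [of s] f0 by (cases "s = 0") (auto simp: field_simps)
  have bounded_simple: "y e \<noteq> 0 \<or> D01 y e \<noteq> 0"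
    if "bvp_solution p \<alpha> \<beta> q w f y" "nontrivial y" "e \<in> {0..1}" "\<forall>s>0. g s < L" for y e L
  proof (rule simple_zeros_if_bounded_ratio [OF p C1 _ that(2) _ that(3), where M = L])
    show "solves p q w f y" using that(1) by (simp add: bvp_solution_iff)
    show "\<bar>f s\<bar> \<le> L * \<bar>s\<bar> powr (p - 1)" for s
    proof (cases "s = 0")
      case False
      then have "0 < g \<bar>s\<bar>" "g \<bar>s\<bar> < L" using gpos that(4) by auto
      then show ?thesis unfolding f_eq [of s] abs_mult abs_spow by (intro mult_right_mono) auto
    qed (simp add: f0)
  qed
  have "\<not> (\<exists>y. bvp_solution p \<alpha> \<beta> q w f y \<and> has_exactly_zeros i y)"
    if less: "\<forall>s>0. g s < lam n" and i: "i \<ge> n" for n i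
  proof
    assume "\<exists>y. bvp_solution p \<alpha> \<beta> q w f y \<and> has_exactly_zeros i y"
    then obtain y where y: "bvp_solution p \<alpha> \<beta> q w f y" and z: "finite (interior_zeros y)" "card (interior_zeros y) = i"
      by (auto simp: has_exactly_zeros_def)
    have "card (interior_zeros y) < n"
      by (rule bvp_few_zeros [OF eig y bounded_simple [OF y nontrivial_if_finite_zeros [OF z(1)] _ less] _ z(1)])
         (use less ratio in auto)
    then show False using z i by simp
  qed
  moreover have "\<not> (\<exists>y. bvp_solution p \<alpha> \<beta> q w f y \<and> has_exactly_zeros i y)"
    if less: "\<forall>s>0. lam n < g s" and i: "i \<le> n" for n i
  proof
    assume "\<exists>y. bvp_solution p \<alpha> \<beta> q w f y \<and> has_exactly_zeros i y"
    then obtain y where y: "bvp_solution p \<alpha> \<beta> q w f y" and z: "finite (interior_zeros y)" "card (interior_zeros y) = i"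
      by (auto simp: has_exactly_zeros_def)
    have sgn: "0 \<le> sgn s * f s" for s
      unfolding f_eq [of s] using gpos [of "\<bar>s\<bar>"]
      by (cases "s = 0") (auto simp: spow_def sgn_if zero_le_mult_iff)
    have simple: "y e \<noteq> 0 \<or> D01 y e \<noteq> 0" if "e \<in> {0..1}" for e
      by (rule simple_zeros_if_sign_preserving [OF p C1 _ z(1) sgn that]) (use y in \<open>simp add: bvp_solution_iff\<close>)
    have "\<exists>X \<subseteq> interior_zeros y. finite X \<and> card X = n + 1"
      by (rule bvp_many_zeros [OF eig y simple]) (use less ratio in auto)
    then have "n + 1 \<le> card (interior_zeros y)" using card_mono [OF z(1)] by metis
    then show False using z i by simp
  qed
  moreover have "\<not> (\<exists>y. bvp_solution p \<alpha> \<beta> q w f y \<and> nontrivial y)"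
    if ne: "\<forall>n. \<forall>s>0. g s \<noteq> lam n"
  proof
    assume "\<exists>y. bvp_solution p \<alpha> \<beta> q w f y \<and> nontrivial y"
    then obtain y where y: "bvp_solution p \<alpha> \<beta> q w f y" "nontrivial y" by blast
    have "connected (g ` {0<..})"
    proof (rule connected_continuous_image)
      have "continuous_on {0<..} f" using C2 continuous_on_subset by (auto simp: cond_C2_def)
      then show "continuous_on {0<..} g" unfolding g_def by (intro continuous_intros) auto
    qed auto
    then have side: "g s < lam n \<longleftrightarrow> g t < lam n" if "s > 0" "t > 0" for s t n
      using connectedD_interval [of "g ` {0<..}" "g s" "g t" "lam n"]
        connectedD_interval [of "g ` {0<..}" "g t" "g s" "lam n"] ne that
      by (smt (verit) greaterThan_iff image_iff)
    \<comment> \<open>By connectedness all values of \<open>g\<close> lie in the same gap between eigenvalues as \<open>g 1\<close>.\<close>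
    define n where "n = (LEAST n. g 1 < lam n)"
    obtain m where "g 1 \<le> lam m" using eigenvalues_unbounded [OF eig] by blast
    then have "g 1 < lam m" using ne by (simp add: less_le)
    then have "g 1 < lam n" unfolding n_def by (rule LeastI)
    then have upper: "\<forall>s>0. g s < lam n" using side [OF _ zero_less_one] by blast
    note simple = bounded_simple [OF y _ upper]
    have few: "card X < n" if "finite X" "X \<subseteq> interior_zeros y" for X
      by (rule bvp_few_zeros [OF eig y(1) simple _ that]) (use upper ratio in auto)
    then obtain k where k: "n = Suc k" using few [of "{}"] gr0_conv_Suc by auto
    then have "\<not> g 1 < lam k" using not_less_Least [of k "\<lambda>n. g 1 < lam n"] by (simp add: n_def)
    then have ge: "\<forall>s>0. \<not> g s < lam k" using side [OF _ zero_less_one] by blast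
    have lower: "\<forall>s>0. lam k < g s"
    proof (intro allI impI)
      fix s :: real assume "s > 0"
      then have "\<not> g s < lam k" "g s \<noteq> lam k" using ge ne by blast+
      then show "lam k < g s" by linarith
    qed
    have "\<exists>X \<subseteq> interior_zeros y. finite X \<and> card X = k + 1"
      by (rule bvp_many_zeros [OF eig y(1) simple]) (use lower ratio in auto)
    then obtain X where "X \<subseteq> interior_zeros y" "finite X" "card X = k + 1" by blast
    then show False using few [of X] k by simp
  qed
  ultimately show ?thesis unfolding g_def by blast
qed

end
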